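(* Let $S,X,T$ be random variables on finite alphabets with joint distribution $P_{S,X,T}$, with full-support marginals, such that $S-T-X$ is a Markov chain and the matrices $P_{T|X}$ and $P_{S|T}$ are invertible (so $|\mathcal S|=|\mathcal X|=|\mathcal T|$). Let $r\ge 0$ be fixed. For $\epsilon>0$ let $$g^{r}_{\epsilon,\chi^2}(P_{S,X,T})=\sup_{P_{Y|X}} I(Y;T),$$ where the supremum is over all conditional distributions $P_{Y|X}$, with $Y$ taking values in a finite alphabet $\mathcal Y$, such that $S-X-Y$ and $T-X-Y$ are Markov chains, $I(Y;S|T)=0$, $\chi^2(P_{S|Y=y};P_S)\le \epsilon^2$ for all $y$, and $I(X;Y)\le r$. Let $$P_2(\epsilon)=\max\ \frac12\epsilon^2\sum_y P_y\|W^{T;Y}L_y\|^2,$$ where the maximum is over all finite alphabets $\mathcal Y$, probability distributions $(P_y)_{y\in\mathcal Y}$ and vectors $L_y\in\mathbb R^{|\mathcal S|}$ satisfying $L_y\perp\sqrt{P_S}$ for all $y$, $\sum_y P_yL_y=0$, $\|L_y\|^2\le 1$ for all $y$, and $\frac12\epsilon^2\sum_yP_y\|W^{X;Y}L_y\|^2\le r$. Then, for $0<\epsilon<\min\{c_1,c_2\}$, $g^{r}_{\epsilon,\chi^2}(P_{S,X,T})$ is approximated by $P_2(\epsilon)$ up to second order, i.e. $$g^{r}_{\epsilon,\chi^2}(P_{S,X,T})=P_2(\epsilon)+o(\epsilon^2),$$ where $o(\epsilon^2)$ denotes a function $f(\epsilon)$ defined for $0<\epsilon<\min\{c_1,c_2\}$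 with $f(\epsilon)/\epsilon^2\to0$ as $\epsilon\to0$.
   Context: Distributions are regarded as column vectors, e.g. $P_S\in\mathbb R^{|\mathcal S|}$. $P_{S|T}$ is the matrix with entries $P_{S|T}(s|t)$ in row $s$, column $t$ (so $P_S=P_{S|T}P_T$), and similarly $P_{T|X}$ (so $P_T=P_{T|X}P_X$). $A-B-C$ being a Markov chain means $A$ and $C$ are conditionally independent given $B$. Mutual information $I$ uses the natural logarithm. $\|\cdot\|$ is the Euclidean norm. $\sqrt{P_S}$ is the vector with entries $\sqrt{P_S(s)}$; $[\sqrt{P_S}]$ is the diagonal matrix with these entries and $[\sqrt{P_S}^{-1}]$ is its inverse; similarly for $P_T,P_X$. $\sigma_{\max}$, $\sigma_{\min}$ denote the largest and smallest singular values of a matrix. Definitions: $$\chi^2(P_{S|Y=y};P_S)=\sum_s\frac{(P_{S|Y=y}(s)-P_S(s))^2}{P_S(s)}$$ (considered for $y$ with $P_Y(y)>0$), $$W^{T;Y}=[\sqrt{P_T}^{-1}]P_{S|T}^{-1}[\sqrt{P_S}],\qquad W^{X;Y}=[\sqrt{P_X}^{-1}]P_{T|X}^{-1}P_{S|T}^{-1}[\sqrt{P_S}],$$ $$c_1=\frac{\min_{x}P_X(x)}{\sigma_{\max}(P_{T|X}^{-1}P_{S|T}^{-1})\sqrt{\max_{s}P_S(s)}},\qquad c_2=\frac{\sigma_{\min}(P_{S|T})\min_{t}P_T(t)}{\sqrt{\max_{s}P_S(s)}}.$$ *)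

theory Defs
  imports "HOL-Probability.Probability"
begin

section \<open>Probability\<close>

abbreviation prob_at :: "'o pmf \<Rightarrow> ('o \<Rightarrow> 'a) \<Rightarrow> 'a \<Rightarrow> real" where
  "prob_at Q A a \<equiv> \<P>(\<omega> in measure_pmf Q. A \<omega> = a)"

abbreviation cprob_at :: "'o pmf \<Rightarrow> ('o \<Rightarrow> 'a) \<Rightarrow> 'a \<Rightarrow> ('o \<Rightarrow> 'b) \<Rightarrow> 'b \<Rightarrow> real" where
  "cprob_at Q A a B b \<equiv> \<P>(\<omega> in measure_pmf Q. A \<omega> = a \<bar> B \<omega> = b)"

definition markov_chain ::
    "'o pmf \<Rightarrow> ('o \<Rightarrow> 'a) \<Rightarrow> ('o \<Rightarrow> 'b) \<Rightarrow> ('o \<Rightarrow> 'c) \<Rightarrow> bool" where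
  "markov_chain Q A B C \<longleftrightarrow>
     (\<forall>a b c. prob_at Q B b > 0 \<longrightarrow>
        \<P>(\<omega> in measure_pmf Q. A \<omega> = a \<and> C \<omega> = c \<bar> B \<omega> = b)
          = cprob_at Q A a B b * cprob_at Q C c B b)"

text \<open>Mutual informations are to the base \<open>exp 1\<close>, that is, in nats.\<close>

definition mutual_info :: "'o pmf \<Rightarrow> ('o \<Rightarrow> 'a) \<Rightarrow> ('o \<Rightarrow> 'b) \<Rightarrow> real" where
  "mutual_info Q A B =
     prob_space.mutual_information (measure_pmf Q) (exp 1)
       (count_space UNIV) (count_space UNIV) A B"

definition cond_mutual_info ::
    "'o pmf \<Rightarrow> ('o \<Rightarrow> 'a) \<Rightarrow> ('o \<Rightarrow> 'b) \<Rightarrow> ('o \<Rightarrow> 'c) \<Rightarrow> real" where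
  "cond_mutual_info Q A B C =
     prob_space.conditional_mutual_information (measure_pmf Q) (exp 1)
       (count_space UNIV) (count_space UNIV) (count_space UNIV) A B C"

definition chi_square :: "('a::finite \<Rightarrow> real) \<Rightarrow> ('a \<Rightarrow> real) \<Rightarrow> real" where
  "chi_square p q = (\<Sum>a\<in>UNIV. (p a - q a)\<^sup>2 / q a)"

section \<open>Vectors and matrices\<close>

definition distr_vec :: "'o pmf \<Rightarrow> ('o \<Rightarrow> 'a::finite) \<Rightarrow> real^'a" where
  "distr_vec Q A = (\<chi> a. prob_at Q A a)"

text \<open>Rows are indexed by the values of \<open>A\<close>, columns by the values of \<open>B\<close>.\<close>

definition cond_matrix ::
    "'o pmf \<Rightarrow> ('o \<Rightarrow> 'a::finite) \<Rightarrow> ('o \<Rightarrow> 'b::finite) \<Rightarrow> real^'b^'a" where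
  "cond_matrix Q A B = (\<chi> a b. cprob_at Q A a B b)"

definition sqrt_vec :: "real^'a \<Rightarrow> real^'a" where
  "sqrt_vec v = (\<chi> i. sqrt (v $ i))"

definition diag_mat :: "real^'a \<Rightarrow> real^'a^'a" where
  "diag_mat v = (\<chi> i j. if i = j then v $ i else 0)"

text \<open>
  Singular values of \<open>M\<close> are the square roots of the eigenvalues of the Gram matrix
  \<open>transpose M ** M\<close>.  They are used below for square matrices only (possibly with different
  index types of the same cardinality for rows and columns).
\<close>

definition singular_values :: "real^'n^'m \<Rightarrow> real set" where
  "singular_values M =
     {sqrt l | l. \<exists>v. v \<noteq> 0 \<and> (transpose M ** M) *v v = l *\<^sub>R v}"

definition sigma_max :: "real^'n^'m \<Rightarrow> real" where
  "sigma_max M = Max (singular_values M)"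

definition sigma_min :: "real^'n^'m \<Rightarrow> real" where
  "sigma_min M = Min (singular_values M)"

section \<open>The three given random variables\<close>

text \<open>
  A joint distribution of \<open>(S, X, T)\<close> is a pmf on triples in this order, the alphabets being
  arbitrary finite types; the random variables are the coordinate projections.
\<close>

definition rvS :: "'s \<times> 'x \<times> 't \<Rightarrow> 's" where "rvS = fst"
definition rvX :: "'s \<times> 'x \<times> 't \<Rightarrow> 'x" where "rvX = fst \<circ> snd"
definition rvT :: "'s \<times> 'x \<times> 't \<Rightarrow> 't" where "rvT = snd \<circ> snd"

context
  fixes P :: "('s::finite \<times> 'x::finite \<times> 't::finite) pmf"
begin

definition W_TY :: "real^'s^'t" where
  "W_TY = matrix_inv (diag_mat (sqrt_vec (distr_vec P rvT)))
            ** matrix_inv (cond_matrix P rvS rvT)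
            ** diag_mat (sqrt_vec (distr_vec P rvS))"

definition W_XY :: "real^'s^'x" where
  "W_XY = matrix_inv (diag_mat (sqrt_vec (distr_vec P rvX)))
            ** matrix_inv (cond_matrix P rvT rvX)
            ** matrix_inv (cond_matrix P rvS rvT)
            ** diag_mat (sqrt_vec (distr_vec P rvS))"

definition c1 :: real where
  "c1 = Min (range (prob_at P rvX))
          / (sigma_max (matrix_inv (cond_matrix P rvT rvX) ** matrix_inv (cond_matrix P rvS rvT))
              * sqrt (Max (range (prob_at P rvS))))"

definition c2 :: real where
  "c2 = sigma_min (cond_matrix P rvS rvT) * Min (range (prob_at P rvT))
          / sqrt (Max (range (prob_at P rvS)))"

section \<open>The two optimization problems\<close>

text \<open>
  Arbitrary finite alphabets for \<open>Y\<close> are represented, up to relabelling, by arbitrary finite sets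
  \<open>\<Y>\<close> of natural numbers.  The kernel \<open>K\<close> is \<open>P\<^bsub>Y|X\<^esub>\<close>, and \<open>Q\<close> is a joint
  distribution of \<open>((S, X, T), Y)\<close> that extends \<open>P\<close> and has \<open>K\<close> as conditional distribution of
  \<open>Y\<close> given \<open>X\<close>.
\<close>

definition admissible ::
    "real \<Rightarrow> real \<Rightarrow> nat set \<Rightarrow> ('x \<Rightarrow> nat pmf) \<Rightarrow> (('s \<times> 'x \<times> 't) \<times> nat) pmf \<Rightarrow> bool" where
  "admissible r \<epsilon> \<Y> K Q \<longleftrightarrow>
     finite \<Y> \<and> (\<forall>x. set_pmf (K x) \<subseteq> \<Y>) \<and>
     map_pmf fst Q = P \<and>
     (\<forall>x y. cprob_at Q snd y (rvX \<circ> fst) x = pmf (K x) y) \<and>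
     markov_chain Q (rvS \<circ> fst) (rvX \<circ> fst) snd \<and>
     markov_chain Q (rvT \<circ> fst) (rvX \<circ> fst) snd \<and>
     cond_mutual_info Q snd (rvS \<circ> fst) (rvT \<circ> fst) = 0 \<and>
     (\<forall>y\<in>\<Y>. prob_at Q snd y > 0 \<longrightarrow>
        chi_square (\<lambda>s. cprob_at Q (rvS \<circ> fst) s snd y) (prob_at P rvS) \<le> \<epsilon>\<^sup>2) \<and>
     mutual_info Q (rvX \<circ> fst) snd \<le> r"

text \<open>
  For \<open>r \<ge> 0\<close> the set below is nonempty (take \<open>Y\<close> constant) and bounded above (by the entropy of
  \<open>T\<close>), so the supremum is a genuine one.
\<close>

definition g_chi2 :: "real \<Rightarrow> real \<Rightarrow> real" where
  "g_chi2 r \<epsilon> =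
     Sup {mutual_info Q snd (rvT \<circ> fst) | \<Y> K Q. admissible r \<epsilon> \<Y> K Q}"

definition P2_values :: "real \<Rightarrow> real \<Rightarrow> real set" where
  "P2_values r \<epsilon> =
     {1/2 * \<epsilon>\<^sup>2 * (\<Sum>y\<in>\<Y>. pmf p y * (norm (W_TY *v L y))\<^sup>2) | (\<Y> :: nat set) p L.
        finite \<Y> \<and> set_pmf p \<subseteq> \<Y> \<and>
        (\<forall>y\<in>\<Y>. orthogonal (L y) (sqrt_vec (distr_vec P rvS))) \<and>
        (\<Sum>y\<in>\<Y>. pmf p y *\<^sub>R L y) = 0 \<and>
        (\<forall>y\<in>\<Y>. (norm (L y))\<^sup>2 \<le> 1) \<and>
        1/2 * \<epsilon>\<^sup>2 * (\<Sum>y\<in>\<Y>. pmf p y * (norm (W_XY *v L y))\<^sup>2) \<le> r}"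

text \<open>
  That this supremum is a maximum is a claim of its own; the theorem states it explicitly.
\<close>

definition P2 :: "real \<Rightarrow> real \<Rightarrow> real" where
  "P2 r \<epsilon> = Sup (P2_values r \<epsilon>)"

end

end

theory Submission
  imports Defs
begin

text \<open>
  Put \<open>l\<^sub>y = (P\<^bsub>S|Y=y\<^esub> - P\<^sub>S) / sqrt P\<^sub>S\<close>. The Markov conditions give
  \<open>P\<^bsub>S|Y=y\<^esub> = P\<^bsub>S|T\<^esub> P\<^bsub>T|X\<^esub> P\<^bsub>X|Y=y\<^esub>\<close>, so inverting the channels shows that \<open>P\<^bsub>T|Y=y\<^esub>\<close> and
  \<open>P\<^bsub>X|Y=y\<^esub>\<close> differ from the marginals by \<open>sqrt P\<^sub>T \<cdot> W\<^bsup>T;Y\<^esup> l\<^sub>y\<close> and \<open>sqrt P\<^sub>X \<cdot> W\<^bsup>X;Y\<^esup> l\<^sub>y\<close>. Since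
  \<open>norm l\<^sub>y \<le> \<epsilon>\<close>, a relative entropy is half of its \<open>\<chi>\<^sup>2\<close>-divergence up to a relative error \<open>O(\<epsilon>)\<close>, uniformly
  in the kernel. As \<open>r\<close> is fixed, there are only two cases for small \<open>\<epsilon>\<close>: if \<open>r > 0\<close>, both rate
  constraints are inactive and both problems reduce to maximising the norm of \<open>W\<^bsup>T;Y\<^esup> l\<close> over the unit ball
  of the orthogonal complement of \<open>sqrt P\<^sub>S\<close>, a uniform bit \<open>Y\<close> tilting \<open>X\<close> along plus or minus a maximiser
  being asymptotically optimal; if \<open>r = 0\<close>, both values vanish.
\<close>

section \<open>Relative entropy and matrices\<close>

definition kl_div :: "('a::finite \<Rightarrow> real) \<Rightarrow> ('a \<Rightarrow> real) \<Rightarrow> real" where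
  "kl_div q p = (\<Sum>a\<in>UNIV. q a * ln (q a / p a))"

text \<open>Third-order Taylor expansion at 0: the third derivative of
  \<open>(1 + x) * ln (1 + x)\<close> is \<open>- 1 / (1 + x)\<^sup>2\<close>, at most 4 in absolute
  value for \<open>\<bar>x\<bar> \<le> 1/2\<close>, and 4/6 is below 1.\<close>

lemma one_plus_ln_one_plus_bound:
  fixes u :: real
  assumes "\<bar>u\<bar> \<le> 1/2"
  shows "\<bar>(1 + u) * ln (1 + u) - u - u\<^sup>2 / 2\<bar> \<le> \<bar>u\<bar> * u\<^sup>2"
proof -
  \<comment> \<open>The function and its first three derivatives; the last branch is read only at
    \<open>m = 3\<close>.\<close>
  define f where "f = (\<lambda>(m::nat) x::real. if m = 0 then (1 + x) * ln (1 + x)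
     else if m = 1 then ln (1 + x) + 1 else if m = 2 then 1 / (1 + x) else - 1 / (1 + x)\<^sup>2)"
  show ?thesis
  proof (cases "u = 0")
    case False
    have "\<exists>t. (if u < 0 then u < t \<and> t < 0 else 0 < t \<and> t < u) \<and>
      (1 + u) * ln (1 + u) = (\<Sum>m<3. f m 0 / fact m * (u - 0) ^ m) + f 3 t / fact 3 * (u - 0) ^ 3"
    proof (rule Taylor[where a = "- 1/2" and b = "1/2"])
      show "\<forall>m t. m < 3 \<and> - 1 / 2 \<le> t \<and> t \<le> 1 / 2 \<longrightarrow> DERIV (f m) t :> f (Suc m) t"
      proof (intro allI impI)
        fix m :: nat and t :: real
        assume *: "m < 3 \<and> - 1 / 2 \<le> t \<and> t \<le> 1 / 2"
        then consider "m = 0" | "m = 1" | "m = 2" by linarith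
        then show "DERIV (f m) t :> f (Suc m) t"
          using * by cases (auto simp: f_def power2_eq_square intro!: derivative_eq_intros)
      qed
    qed (use assms False in \<open>auto simp: f_def fun_eq_iff\<close>)
    then obtain t where between: "if u < 0 then u < t \<and> t < 0 else 0 < t \<and> t < u"
      and taylor: "(1 + u) * ln (1 + u) = (\<Sum>m<3. f m 0 / fact m * (u - 0) ^ m) + f 3 t / fact 3 * (u - 0) ^ 3"
      by blast
    have t: "\<bar>t\<bar> \<le> 1/2"
      using between assms by (auto split: if_splits)
    have eq: "(1 + u) * ln (1 + u) = u + u\<^sup>2 / 2 - u ^ 3 / (6 * (1 + t)\<^sup>2)"
      unfolding taylor by (simp add: f_def eval_nat_numeral)
    have "(1/2)\<^sup>2 \<le> (1 + t)\<^sup>2"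
      using t by (intro power_mono) auto
    then have "1 \<le> 6 * (1 + t)\<^sup>2" by (simp add: power2_eq_square)
    then have "\<bar>u\<bar> ^ 3 / (6 * (1 + t)\<^sup>2) \<le> \<bar>u\<bar> ^ 3 / 1"
      by (intro divide_left_mono) auto
    then show ?thesis
      unfolding eq by (simp add: abs_mult power3_eq_cube power2_eq_square)
  qed simp
qed

text \<open>Write \<open>q = p * (1 + u)\<close>. Equal total mass cancels the linear terms of the
  expansion, the quadratic terms add up to half the chi-square, and the cubic remainder is at most
  the chi-square times the bound \<open>\<delta>\<close> on \<open>\<bar>u\<bar>\<close>.\<close>

lemma kl_div_chi_square:
  fixes p q :: "'a::finite \<Rightarrow> real"
  assumes p: "\<And>a. p a > 0" and sum: "sum q UNIV = sum p UNIV"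
    and close: "\<And>a. \<bar>q a - p a\<bar> \<le> \<delta> * p a" and \<delta>: "\<delta> \<le> 1/2"
  shows "\<bar>kl_div q p - chi_square q p / 2\<bar> \<le> \<delta> * chi_square q p"
proof -
  define u where "u a = (q a - p a) / p a" for a
  have q: "q a = p a * (1 + u a)" for a
    using p[of a] by (simp add: u_def field_simps)
  have u: "\<bar>u a\<bar> \<le> \<delta>" for a
    using close[of a] p[of a] by (simp add: u_def field_simps)
  have chi: "chi_square q p = (\<Sum>a\<in>UNIV. p a * (u a)\<^sup>2)"
    unfolding chi_square_def
    by (rule sum.cong[OF refl]) (use p in \<open>auto simp: u_def power2_eq_square\<close>)
  have "(\<Sum>a\<in>UNIV. p a * u a) = 0"
    using sum by (simp add: q algebra_simps sum.distrib)
  moreover have "kl_div q p = (\<Sum>a\<in>UNIV. p a * ((1 + u a) * ln (1 + u a)))"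
    unfolding kl_div_def q by (rule sum.cong[OF refl]) (use p in \<open>auto simp: less_imp_neq[symmetric]\<close>)
  ultimately have "kl_div q p - chi_square q p / 2 =
      (\<Sum>a\<in>UNIV. p a * ((1 + u a) * ln (1 + u a) - u a - (u a)\<^sup>2 / 2))"
    by (simp add: chi right_diff_distrib sum_subtractf sum_divide_distrib)
  also have "\<bar>\<dots>\<bar> \<le> (\<Sum>a\<in>UNIV. p a * (\<delta> * (u a)\<^sup>2))"
  proof (rule order_trans[OF sum_abs sum_mono])
    fix a
    have "\<bar>(1 + u a) * ln (1 + u a) - u a - (u a)\<^sup>2 / 2\<bar> \<le> \<bar>u a\<bar> * (u a)\<^sup>2"
      using u[of a] \<delta> by (intro one_plus_ln_one_plus_bound) simp
    also have "\<dots> \<le> \<delta> * (u a)\<^sup>2"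
      by (intro mult_right_mono u) simp
    finally show "\<bar>p a * ((1 + u a) * ln (1 + u a) - u a - (u a)\<^sup>2 / 2)\<bar> \<le> p a * (\<delta> * (u a)\<^sup>2)"
      using p[of a] by (simp add: abs_mult)
  qed
  also have "\<dots> = \<delta> * chi_square q p"
    by (simp add: chi sum_distrib_left mult_ac)
  finally show ?thesis .
qed

section \<open>Matrix inverses, diagonal scaling and bounds for linear maps\<close>

lemma matrix_inv_vector:
  fixes M :: "real^'n^'m"
  assumes "invertible M"
  shows "M *v (matrix_inv M *v v) = v" "matrix_inv M *v (M *v w) = w"
proof -
  from assms have "M ** matrix_inv M = mat 1 \<and> matrix_inv M ** M = mat 1"
    unfolding invertible_def matrix_inv_def by (rule someI_ex)
  then show "M *v (matrix_inv M *v v) = v" "matrix_inv M *v (M *v w) = w"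
    by (simp_all add: matrix_vector_mul_assoc)
qed

lemma diag_mat_vector: "diag_mat v *v w = (\<chi> i. v $ i * w $ i)"
  by (simp add: diag_mat_def matrix_vector_mult_def vec_eq_iff if_distrib if_distribR cong: if_cong)

lemma invertible_diag_mat:
  assumes "\<And>i. v $ i \<noteq> 0"
  shows "invertible (diag_mat v)"
proof -
  have "diag_mat v ** diag_mat w = mat 1" if "\<And>i. v $ i * w $ i = 1" for v w :: "real^'n"
    unfolding matrix_eq using that
    by (simp add: diag_mat_vector vec_eq_iff flip: matrix_vector_mul_assoc mult.assoc)
  from this[of v "\<chi> i. 1 / v $ i"] this[of "\<chi> i. 1 / v $ i" v] assms show ?thesis
    unfolding invertible_def by (intro exI[of _ "diag_mat (\<chi> i. 1 / v $ i)"]) auto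
qed

text \<open>Conservation of mass under a channel; later it gives the perturbations of the three laws
  equal totals.\<close>

lemma sum_matrix_vector:
  fixes M :: "real^'n^'m"
  assumes "\<And>j. (\<Sum>i\<in>UNIV. M $ i $ j) = 1"
  shows "(\<Sum>i\<in>UNIV. (M *v w) $ i) = (\<Sum>j\<in>UNIV. w $ j)"
proof -
  have "(\<Sum>i\<in>UNIV. (M *v w) $ i) = (\<Sum>j\<in>UNIV. \<Sum>i\<in>UNIV. M $ i $ j * w $ j)"
    unfolding matrix_vector_mult_def by simp (rule sum.swap)
  then show ?thesis by (simp add: assms flip: sum_distrib_right)
qed

text \<open>Boundedness in finite dimension gives \<open>K * norm l\<close>; dividing by the least
  \<open>p i\<close> makes the bound relative to \<open>p\<close>, as
  \<open>kl_div_chi_square\<close> requires.\<close>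

lemma linear_component_bound:
  fixes f :: "'n::euclidean_space \<Rightarrow> real^'m"
  assumes f: "linear f" and p: "\<And>i. p i > 0"
  obtains C where "C > 0" "\<And>l i. \<bar>f l $ i\<bar> \<le> C * norm l * p i"
proof -
  obtain K where K: "K > 0" "\<And>l. norm (f l) \<le> norm l * K"
    using bounded_linear.pos_bounded[of f] f by (auto simp: linear_conv_bounded_linear)
  define m where "m = Min (range p)"
  have m: "m > 0" "\<And>i. m \<le> p i"
    using p by (auto simp: m_def)
  show thesis
  proof (rule that[of "K / m"])
    fix l i
    have "\<bar>f l $ i\<bar> \<le> K * norm l"
      using K(2)[of l] component_le_norm_cart[of "f l" i] by (simp add: mult.commute)
    also have "\<dots> \<le> K * norm l * (p i / m)"
      using mult_left_mono[of 1 "p i / m" "K * norm l"] m(1) m(2)[of i] K(1) by simp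
    finally show "\<bar>f l $ i\<bar> \<le> K / m * norm l * p i" by simp
  qed (use K m in auto)
qed

section \<open>Mutual information and Markov chains\<close>

text \<open>Total probability, with \<open>F\<close> covering only the support of \<open>B\<close>,
  so that it applies to \<open>Y\<close>, whose type \<open>nat\<close> is infinite.\<close>

lemma prob_eq_sum_fiber:
  assumes "finite F" "B ` set_pmf Q \<subseteq> F"
  shows "\<P>(\<omega> in measure_pmf Q. \<Phi> \<omega>) = (\<Sum>b\<in>F. \<P>(\<omega> in measure_pmf Q. \<Phi> \<omega> \<and> B \<omega> = b))"
proof -
  have "\<P>(\<omega> in measure_pmf Q. \<Phi> \<omega>) = measure Q (\<Union>b\<in>F. {\<omega>. \<Phi> \<omega> \<and> B \<omega> = b})"
    using assms(2) by (intro measure_pmf.finite_measure_eq_AE) (auto intro!: AE_pmfI)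
  also have "\<dots> = (\<Sum>b\<in>F. measure Q {\<omega>. \<Phi> \<omega> \<and> B \<omega> = b})"
    using assms(1) by (intro measure_pmf.finite_measure_finite_Union) (auto simp: disjoint_family_on_def)
  finally show ?thesis by simp
qed

lemma distributed_pmf:
  "distributed (measure_pmf Q) (count_space UNIV) A (\<lambda>a. ennreal (prob_at Q A a))"
proof -
  have "distr (measure_pmf Q) (count_space UNIV) A = measure_pmf (map_pmf A Q)"
    by (simp add: map_pmf_rep_eq)
  also have "\<dots> = density (count_space UNIV) (\<lambda>a. ennreal (prob_at Q A a))"
    by (subst measure_pmf_eq_density) (simp add: pmf_map vimage_def)
  finally show ?thesis by (simp add: distributed_def)
qed

text \<open>For countable types the product of counting measures is the counting measure on pairs,
  and the joint mass vanishes outside \<open>F \<times> G\<close>; so the integral for mutual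
  information is a finite sum.\<close>

lemma mutual_info_eq_sum:
  fixes A :: "'o \<Rightarrow> 'a::countable" and B :: "'o \<Rightarrow> 'b::countable"
  assumes F: "finite F" "A ` set_pmf Q \<subseteq> F" and G: "finite G" "B ` set_pmf Q \<subseteq> G"
  shows "mutual_info Q A B = (\<Sum>a\<in>F. \<Sum>b\<in>G. 
     \<P>(\<omega> in measure_pmf Q. A \<omega> = a \<and> B \<omega> = b) *
       ln (\<P>(\<omega> in measure_pmf Q. A \<omega> = a \<and> B \<omega> = b) / (prob_at Q A a * prob_at Q B b)))"
proof -
  interpret information_space "measure_pmf Q" "exp 1"
    by unfold_locales simp
  define j where "j = (\<lambda>ab. prob_at Q (\<lambda>\<omega>. (A \<omega>, B \<omega>)) ab)"
  let ?f = "\<lambda>ab. j ab * log (exp 1) (j ab / (prob_at Q A (fst ab) * prob_at Q B (snd ab)))"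
  have pair: "count_space UNIV \<Otimes>\<^sub>M count_space UNIV = (count_space UNIV :: ('a \<times> 'b) measure)"
    by (subst pair_measure_countable) auto
  have zero: "j ab = 0" if "ab \<notin> F \<times> G" for ab
    using that F(2) G(2) unfolding j_def by (auto simp: measure_pmf_zero_iff)
  have "mutual_info Q A B = (\<integral>ab. ?f ab \<partial>(count_space UNIV \<Otimes>\<^sub>M count_space UNIV))"
    unfolding mutual_info_def
  proof (rule mutual_information_distr[where Pxy = j])
    show "distributed (measure_pmf Q) (count_space UNIV \<Otimes>\<^sub>M count_space UNIV) (\<lambda>x. (A x, B x)) (\<lambda>x. ennreal (j x))"
      unfolding pair j_def by (rule distributed_pmf)
    show "distributed (measure_pmf Q) (count_space UNIV) A (\<lambda>a. ennreal (prob_at Q A a))"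
      "distributed (measure_pmf Q) (count_space UNIV) B (\<lambda>b. ennreal (prob_at Q B b))"
      by (rule distributed_pmf)+
  qed (simp_all add: j_def sigma_finite_measure_count_space)
  also have "\<dots> = (\<Sum>ab\<in>F \<times> G. ?f ab)"
  proof -
    have sub: "{ab \<in> UNIV. ?f ab \<noteq> 0} \<subseteq> F \<times> G"
      using zero by fastforce
    then have fin: "finite {ab \<in> UNIV. ?f ab \<noteq> 0}"
      using F(1) G(1) by (meson finite_SigmaI finite_subset)
    show ?thesis
      unfolding pair lebesgue_integral_count_space_finite_support[OF fin]
      using sub F(1) G(1) by (intro sum.mono_neutral_left) auto
  qed
  finally show ?thesis
    by (simp add: sum.cartesian_product[symmetric] j_def log_def sum.cartesian_product')
qed

text \<open>Both argument orders are needed: the leakage is \<open>I(Y;T)\<close>, the rate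
  \<open>I(X;Y)\<close>. As averages of divergences, both can be estimated for each \<open>y\<close>
  separately.\<close>

lemma mutual_info_eq_sum_kl_div:
  fixes A :: "'o \<Rightarrow> 'a::finite" and Y :: "'o \<Rightarrow> nat"
  assumes G: "finite G" "Y ` set_pmf Q \<subseteq> G"
  shows "mutual_info Q Y A = (\<Sum>y\<in>G. prob_at Q Y y * kl_div (\<lambda>a. cprob_at Q A a Y y) (prob_at Q A))"
    and "mutual_info Q A Y = (\<Sum>y\<in>G. prob_at Q Y y * kl_div (\<lambda>a. cprob_at Q A a Y y) (prob_at Q A))"
proof -
  define j where "j y a = measure (measure_pmf Q) {\<omega>. A \<omega> = a \<and> Y \<omega> = y}" for y a
  define pA where "pA a = measure (measure_pmf Q) {\<omega>. A \<omega> = a}" for a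
  define pY where "pY y = measure (measure_pmf Q) {\<omega>. Y \<omega> = y}" for y
  have zero: "j y a = 0" if "pY y = 0" for y a
    using that unfolding j_def pY_def measure_pmf_zero_iff by auto
  have kl: "(\<Sum>y\<in>G. pY y * kl_div (\<lambda>a. j y a / pY y) pA) = (\<Sum>y\<in>G. \<Sum>a\<in>UNIV. j y a * ln (j y a / (pY y * pA a)))"
  proof (rule sum.cong[OF refl])
    fix y
    \<comment> \<open>At \<open>pY y = 0\<close> the joint masses vanish as well, so both sides are
      0 and positivity of \<open>pY\<close> is not assumed.\<close>
    show "pY y * kl_div (\<lambda>a. j y a / pY y) pA = (\<Sum>a\<in>UNIV. j y a * ln (j y a / (pY y * pA a)))"
      by (cases "pY y = 0") (simp_all add: kl_div_def sum_distrib_left zero)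
  qed
  note eq = kl[unfolded j_def[abs_def] pA_def[abs_def] pY_def[abs_def]]
  show "mutual_info Q Y A = (\<Sum>y\<in>G. prob_at Q Y y * kl_div (\<lambda>a. cprob_at Q A a Y y) (prob_at Q A))"
    by (subst mutual_info_eq_sum[of G _ _ UNIV]) (use G in \<open>simp_all add: cond_prob_def eq conj_commute\<close>)
  show "mutual_info Q A Y = (\<Sum>y\<in>G. prob_at Q Y y * kl_div (\<lambda>a. cprob_at Q A a Y y) (prob_at Q A))"
    by (subst mutual_info_eq_sum[of UNIV _ _ G], simp_all add: G, subst sum.swap)
      (simp add: cond_prob_def eq mult.commute)
qed

section \<open>Conditional independence\<close>

lemma markov_chain_joint:
  assumes "markov_chain Q A B C"
  shows "\<P>(\<omega> in measure_pmf Q. (A \<omega> = a \<and> C \<omega> = c) \<and> B \<omega> = b) =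
    cprob_at Q A a B b * \<P>(\<omega> in measure_pmf Q. C \<omega> = c \<and> B \<omega> = b)"
proof (cases "prob_at Q B b > 0")
  case True
  then show ?thesis
    using assms by (force simp: markov_chain_def cond_prob_def field_simps)
next
  \<comment> \<open>\<open>markov_chain\<close> says nothing about such \<open>b\<close>; the
    identity survives because both joint masses vanish.\<close>
  case False
  then have "prob_at Q B b = 0"
    using measure_nonneg[of "measure_pmf Q"] by (simp add: not_less antisym)
  then have "\<P>(\<omega> in measure_pmf Q. \<Phi> \<omega> \<and> B \<omega> = b) = 0" for \<Phi>
    by (auto simp: measure_pmf_zero_iff)
  then show ?thesis by (simp only: mult_zero_right)
qed

lemma markov_chain_sum:
  fixes B :: "'o \<Rightarrow> 'b::finite"
  assumes "markov_chain Q A B C"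
  shows "\<P>(\<omega> in measure_pmf Q. A \<omega> = a \<and> C \<omega> = c) =
    (\<Sum>b\<in>UNIV. cprob_at Q A a B b * \<P>(\<omega> in measure_pmf Q. C \<omega> = c \<and> B \<omega> = b))"
  unfolding markov_chain_joint[OF assms, symmetric] by (rule prob_eq_sum_fiber) simp_all

lemma sum_cprob_at:
  fixes A :: "'o \<Rightarrow> 'a::finite"
  assumes "prob_at Q B b > 0"
  shows "(\<Sum>a\<in>UNIV. cprob_at Q A a B b) = 1"
  using assms prob_eq_sum_fiber[of UNIV A Q "\<lambda>\<omega>. B \<omega> = b"]
  by (simp add: cond_prob_def conj_commute flip: sum_divide_distrib)

text \<open>Conditional mutual information is by definition \<open>I(Y;(A,B)) - I(Y;B)\<close>. The
  conditional probability of \<open>A\<close> given \<open>B\<close> cancels inside the logarithm of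
  the first term and sums to 1 over \<open>a\<close>, which leaves the second term.\<close>

lemma cond_mutual_info_markov:
  fixes A :: "'o \<Rightarrow> 'a::finite" and B :: "'o \<Rightarrow> 'b::finite" and Y :: "'o \<Rightarrow> nat"
  assumes mc: "markov_chain Q A B Y" and G: "finite G" "Y ` set_pmf Q \<subseteq> G"
  shows "cond_mutual_info Q Y A B = 0"
proof -
  define c where "c a b = cprob_at Q A a B b" for a b
  define j where "j y b = \<P>(\<omega> in measure_pmf Q. Y \<omega> = y \<and> B \<omega> = b)" for y b
  define L where "L y b = ln (j y b / (prob_at Q Y y * prob_at Q B b))" for y b
  have joint: "\<P>(\<omega> in measure_pmf Q. Y \<omega> = y \<and> (A \<omega>, B \<omega>) = (a, b)) = c a b * j y b" for a b y
    using markov_chain_joint[OF mc, of a y b] by (simp add: c_def j_def conj_ac)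
  have AB: "prob_at Q (\<lambda>\<omega>. (A \<omega>, B \<omega>)) (a, b) = c a b * prob_at Q B b" for a b
  proof (cases "prob_at Q B b = 0")
    case True
    then have "prob_at Q (\<lambda>\<omega>. (A \<omega>, B \<omega>)) (a, b) = 0"
      by (auto simp: measure_pmf_zero_iff)
    with True show ?thesis by simp
  qed (simp add: c_def cond_prob_def)
  have pair: "count_space UNIV \<Otimes>\<^sub>M count_space UNIV = (count_space UNIV :: ('a \<times> 'b) measure)"
    by (subst pair_measure_countable) auto
  have "mutual_info Q Y (\<lambda>\<omega>. (A \<omega>, B \<omega>)) = (\<Sum>y\<in>G. \<Sum>ab\<in>UNIV.
      c (fst ab) (snd ab) * j y (snd ab) * ln (c (fst ab) (snd ab) * j y (snd ab)
        / (prob_at Q Y y * (c (fst ab) (snd ab) * prob_at Q B (snd ab)))))"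
    using joint AB by (subst mutual_info_eq_sum[OF G finite_class.finite_UNIV]) (auto intro!: sum.cong)
  \<comment> \<open>Where \<open>c\<close> is 0 both summands vanish, so it may be cancelled under
    the logarithm.\<close>
  also have "\<dots> = (\<Sum>y\<in>G. \<Sum>ab\<in>UNIV. c (fst ab) (snd ab) * (j y (snd ab) * L y (snd ab)))"
    by (intro sum.cong refl) (auto simp: L_def)
  also have "\<dots> = (\<Sum>y\<in>G. \<Sum>b\<in>UNIV. (\<Sum>a\<in>UNIV. c a b) * (j y b * L y b))"
    unfolding UNIV_Times_UNIV[symmetric] sum.cartesian_product'
    by (subst sum.swap) (simp add: sum_distrib_right)
  also have "\<dots> = (\<Sum>y\<in>G. \<Sum>b\<in>UNIV. j y b * L y b)"
  proof (intro sum.cong refl)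
    fix y b
    show "(\<Sum>a\<in>UNIV. c a b) * (j y b * L y b) = j y b * L y b"
    proof (cases "prob_at Q B b = 0")
      case True
      then have "j y b = 0" by (auto simp: j_def measure_pmf_zero_iff)
      then show ?thesis by simp
    next
      case False
      then have "prob_at Q B b > 0" using measure_nonneg by (simp add: less_le)
      then show ?thesis by (simp add: c_def sum_cprob_at)
    qed
  qed
  also have "\<dots> = mutual_info Q Y B"
    by (subst mutual_info_eq_sum[OF G finite_class.finite_UNIV]) (simp_all add: j_def L_def)
  finally show ?thesis
    by (simp add: cond_mutual_info_def prob_space.conditional_mutual_information_def
        measure_pmf.prob_space_axioms mutual_info_def pair)
qed

section \<open>Perturbations of the source\<close>

text \<open>Scaling by \<open>sqrt p\<close> cancels the denominators, so chi-square balls become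
  Euclidean balls; this is why the square roots enter \<open>W_TY\<close> and
  \<open>W_XY\<close>.\<close>

lemma chi_square_tilt:
  assumes "\<And>i. p $ i > 0"
  shows "chi_square (\<lambda>i. p $ i + (diag_mat (sqrt_vec p) *v w) $ i) (\<lambda>i. p $ i) = (norm w)\<^sup>2"
  using assms
  by (simp add: chi_square_def diag_mat_vector sqrt_vec_def power_mult_distrib less_imp_le less_imp_neq[symmetric]
      norm_vec_def L2_set_def sum_nonneg)

lemma mult_cprob_at: "prob_at Q B b * cprob_at Q A a B b = \<P>(\<omega> in measure_pmf Q. A \<omega> = a \<and> B \<omega> = b)"
  by (cases "prob_at Q B b = 0") (auto simp: cond_prob_def measure_pmf_zero_iff)

lemma distr_vec_cond_matrix: "distr_vec Q A = cond_matrix Q A B *v distr_vec Q B"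
  unfolding vec_eq_iff
proof
  fix i
  show "distr_vec Q A $ i = (cond_matrix Q A B *v distr_vec Q B) $ i"
    using prob_eq_sum_fiber[of UNIV B Q "\<lambda>\<omega>. A \<omega> = i"] mult_cprob_at[of Q B _ A i]
    by (simp add: distr_vec_def cond_matrix_def matrix_vector_mult_def mult.commute)
qed

section \<open>The source and its linearised channels\<close>

locale markov_source =
  fixes P :: "('s::finite \<times> 'x::finite \<times> 't::finite) pmf"
  assumes pos_S: "\<And>s. prob_at P rvS s > 0"
    and pos_X: "\<And>x. prob_at P rvX x > 0"
    and pos_T: "\<And>t. prob_at P rvT t > 0"
    and markov: "markov_chain P rvS rvT rvX"
    and inv_TX: "invertible (cond_matrix P rvT rvX)"
    and inv_ST: "invertible (cond_matrix P rvS rvT)"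
begin

text \<open>
  A vector \<open>l\<close> encodes the perturbation of the law of \<open>S\<close> whose density with respect to \<open>P\<^sub>S\<close> is
  \<open>1 + l / sqrt P\<^sub>S\<close>; the other two functions are the perturbations of the laws of \<open>T\<close> and \<open>X\<close>
  that the channels map to it.
\<close>

definition tiltS :: "real^'s \<Rightarrow> real^'s" where
  "tiltS l = diag_mat (sqrt_vec (distr_vec P rvS)) *v l"

definition tiltT :: "real^'s \<Rightarrow> real^'t" where
  "tiltT l = diag_mat (sqrt_vec (distr_vec P rvT)) *v (W_TY P *v l)"

definition tiltX :: "real^'s \<Rightarrow> real^'x" where
  "tiltX l = diag_mat (sqrt_vec (distr_vec P rvX)) *v (W_XY P *v l)"

lemma invertible_diag_sqrt:
  assumes "\<And>a. prob_at P f a > 0"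
  shows "invertible (diag_mat (sqrt_vec (distr_vec P f)))"
  using assms by (intro invertible_diag_mat) (auto simp: sqrt_vec_def distr_vec_def less_imp_neq[symmetric])

lemma tiltT_eq: "tiltT l = matrix_inv (cond_matrix P rvS rvT) *v tiltS l"
  by (simp add: tiltT_def tiltS_def W_TY_def matrix_inv_vector(1)[OF invertible_diag_sqrt[OF pos_T]]
      flip: matrix_vector_mul_assoc)

lemma tiltX_eq: "tiltX l = matrix_inv (cond_matrix P rvT rvX) *v tiltT l"
  by (simp add: tiltX_def tiltT_eq tiltS_def W_XY_def matrix_inv_vector(1)[OF invertible_diag_sqrt[OF pos_X]]
      flip: matrix_vector_mul_assoc)

lemma cond_matrix_tilt:
  "cond_matrix P rvS rvT *v tiltT l = tiltS l" "cond_matrix P rvT rvX *v tiltX l = tiltT l"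
  by (simp_all add: tiltT_eq tiltX_eq matrix_inv_vector inv_ST inv_TX)

text \<open>Injectivity of the channels; it serves to recognise the conditional laws given
  \<open>Y\<close> as tilts.\<close>

lemma tilt_unique:
  "cond_matrix P rvS rvT *v b = tiltS l \<Longrightarrow> tiltT l = b"
  "cond_matrix P rvT rvX *v d = tiltT l \<Longrightarrow> tiltX l = d"
  using matrix_inv_vector(2)[OF inv_ST, of b] matrix_inv_vector(2)[OF inv_TX, of d]
  by (auto simp: tiltT_eq tiltX_eq)

lemma linear_tilt: "linear tiltT" "linear tiltX"
  unfolding tiltT_def tiltX_def by (simp_all add: matrix_vector_mul_assoc)

lemma chi_square_tiltS: "chi_square (\<lambda>s. prob_at P rvS s + tiltS l $ s) (prob_at P rvS) = (norm l)\<^sup>2"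
  and chi_square_tiltT: "chi_square (\<lambda>t. prob_at P rvT t + tiltT l $ t) (prob_at P rvT) = (norm (W_TY P *v l))\<^sup>2"
  and chi_square_tiltX: "chi_square (\<lambda>x. prob_at P rvX x + tiltX l $ x) (prob_at P rvX) = (norm (W_XY P *v l))\<^sup>2"
  using chi_square_tilt[of "distr_vec P rvS"] chi_square_tilt[of "distr_vec P rvT"]
    chi_square_tilt[of "distr_vec P rvX"] pos_S pos_T pos_X
  by (simp_all add: tiltS_def tiltT_def tiltX_def distr_vec_def)

lemma sum_tiltS: "(\<Sum>s\<in>UNIV. tiltS l $ s) = l \<bullet> sqrt_vec (distr_vec P rvS)"
  by (simp add: tiltS_def diag_mat_vector inner_vec_def mult.commute)

text \<open>The columns of a conditional matrix sum to 1, so a perturbation and its image have the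
  same total. By \<open>sum_tiltS\<close> this total is 0 exactly when \<open>l\<close> is
  orthogonal to \<open>sqrt P\<^sub>S\<close>.\<close>

lemma sum_tilt: "(\<Sum>t\<in>UNIV. tiltT l $ t) = (\<Sum>s\<in>UNIV. tiltS l $ s)"
    "(\<Sum>x\<in>UNIV. tiltX l $ x) = (\<Sum>s\<in>UNIV. tiltS l $ s)"
proof -
  have T: "(\<Sum>i\<in>UNIV. (cond_matrix P rvS rvT *v w) $ i) = (\<Sum>j\<in>UNIV. w $ j)" for w
    by (rule sum_matrix_vector) (use sum_cprob_at[OF pos_T] in \<open>simp add: cond_matrix_def\<close>)
  have X: "(\<Sum>i\<in>UNIV. (cond_matrix P rvT rvX *v w) $ i) = (\<Sum>j\<in>UNIV. w $ j)" for w
    by (rule sum_matrix_vector) (use sum_cprob_at[OF pos_X] in \<open>simp add: cond_matrix_def\<close>)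
  show "(\<Sum>t\<in>UNIV. tiltT l $ t) = (\<Sum>s\<in>UNIV. tiltS l $ s)"
    "(\<Sum>x\<in>UNIV. tiltX l $ x) = (\<Sum>s\<in>UNIV. tiltS l $ s)"
    using T[of "tiltT l"] X[of "tiltX l"] by (simp_all add: cond_matrix_tilt)
qed

text \<open>One constant for both alphabets, independent of \<open>l\<close>: together with
  \<open>norm l \<le> \<epsilon>\<close> it makes all error terms uniform in the kernel.\<close>

lemma tilt_bound:
  obtains C where "C > 0" "\<And>l t. \<bar>tiltT l $ t\<bar> \<le> C * norm l * prob_at P rvT t"
    "\<And>l x. \<bar>tiltX l $ x\<bar> \<le> C * norm l * prob_at P rvX x"
proof -
  obtain C1 where C1: "C1 > 0" "\<And>l t. \<bar>tiltT l $ t\<bar> \<le> C1 * norm l * prob_at P rvT t"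
    by (rule linear_component_bound[OF linear_tilt(1), where p = "prob_at P rvT", OF pos_T]) blast
  obtain C2 where C2: "C2 > 0" "\<And>l x. \<bar>tiltX l $ x\<bar> \<le> C2 * norm l * prob_at P rvX x"
    by (rule linear_component_bound[OF linear_tilt(2), where p = "prob_at P rvX", OF pos_X]) blast
  show thesis
  proof (rule that[of "max C1 C2"])
    fix l :: "real^'s" and t
    have "C1 * norm l * prob_at P rvT t \<le> max C1 C2 * norm l * prob_at P rvT t"
      by (intro mult_right_mono) auto
    then show "\<bar>tiltT l $ t\<bar> \<le> max C1 C2 * norm l * prob_at P rvT t"
      using C1(2)[of l t] by linarith
  next
    fix l :: "real^'s" and x
    have "C2 * norm l * prob_at P rvX x \<le> max C1 C2 * norm l * prob_at P rvX x"
      by (intro mult_right_mono) auto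
    then show "\<bar>tiltX l $ x\<bar> \<le> max C1 C2 * norm l * prob_at P rvX x"
      using C2(2)[of l x] by linarith
  qed (use C1 in auto)
qed

text \<open>The channel from \<open>X\<close> to \<open>T\<close> sends a zero perturbation to zero.
  This is why zero rate forces zero leakage.\<close>

lemma W_TY_eq_0:
  assumes "W_XY P *v l = 0"
  shows "W_TY P *v l = 0"
proof -
  have "tiltX l = 0" using assms by (simp add: tiltX_def)
  then have "tiltT l = 0" using cond_matrix_tilt(2)[of l] by simp
  then show ?thesis using chi_square_tiltT[of l] by (simp add: chi_square_def)
qed

lemma cprob_SX:
  "cprob_at P rvS s rvX x = (\<Sum>t\<in>UNIV. cprob_at P rvS s rvT t * cprob_at P rvT t rvX x)"
  using markov_chain_sum[OF markov, of s x] by (simp add: cond_prob_def sum_divide_distrib conj_commute)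

section \<open>Conditional laws under an admissible kernel\<close>

lemma admissible_extends:
  assumes "admissible P r \<epsilon> \<Y> K Q"
  shows "\<P>(\<omega> in measure_pmf Q. \<Phi> (fst \<omega>)) = \<P>(\<omega> in measure_pmf P. \<Phi> \<omega>)"
proof -
  have "\<P>(\<omega> in measure_pmf P. \<Phi> \<omega>) = \<P>(\<omega> in measure_pmf (map_pmf fst Q). \<Phi> \<omega>)"
    using assms by (simp add: admissible_def)
  then show ?thesis by (simp add: vimage_def)
qed

text \<open>A pair in the support of \<open>Q\<close> has an \<open>x\<close> of positive
  probability, for which \<open>K x\<close> is a genuine conditional law; hence \<open>y\<close>
  lies in the support of \<open>K x\<close>.\<close>

lemma admissible_support:
  assumes adm: "admissible P r \<epsilon> \<Y> K Q"
  shows "finite \<Y>" "snd ` set_pmf Q \<subseteq> \<Y>"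
proof -
  show "finite \<Y>" using adm by (simp add: admissible_def)
  show "snd ` set_pmf Q \<subseteq> \<Y>"
  proof clarify
    fix \<omega> y assume Q: "(\<omega>, y) \<in> set_pmf Q"
    define x where "x = rvX \<omega>"
    have "measure (measure_pmf Q) {\<omega>. snd \<omega> = y \<and> (rvX \<circ> fst) \<omega> = x} \<noteq> 0"
      "prob_at Q (rvX \<circ> fst) x \<noteq> 0"
      using Q by (auto simp: measure_pmf_zero_iff x_def)
    then have "cprob_at Q snd y (rvX \<circ> fst) x \<noteq> 0"
      by (simp add: cond_prob_def)
    then have "y \<in> set_pmf (K x)"
      using adm by (simp add: admissible_def set_pmf_iff)
    then show "snd (\<omega>, y) \<in> \<Y>" using adm by (auto simp: admissible_def)
  qed
qed

text \<open>Translates the constraints at a fixed \<open>y\<close> into geometry: the chi-square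
  bound becomes a norm bound, and equality of total masses becomes orthogonality.\<close>

lemma admissible_tilt:
  assumes adm: "admissible P r \<epsilon> \<Y> K Q" and y: "prob_at Q snd y > 0" and \<epsilon>: "\<epsilon> > 0"
  obtains l where "norm l \<le> \<epsilon>" "orthogonal l (sqrt_vec (distr_vec P rvS))"
    "\<And>t. cprob_at Q (rvT \<circ> fst) t snd y = prob_at P rvT t + tiltT l $ t"
    "\<And>x. cprob_at Q (rvX \<circ> fst) x snd y = prob_at P rvX x + tiltX l $ x"
proof -
  define qS where "qS = (\<chi> s. cprob_at Q (rvS \<circ> fst) s snd y)"
  define qT where "qT = (\<chi> t. cprob_at Q (rvT \<circ> fst) t snd y)"
  define qX where "qX = (\<chi> x. cprob_at Q (rvX \<circ> fst) x snd y)"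
  have ext: "cprob_at Q (f \<circ> fst) a (g \<circ> fst) b = cprob_at P f a g b"
    for f :: "'s \<times> 'x \<times> 't \<Rightarrow> 'a" and g :: "'s \<times> 'x \<times> 't \<Rightarrow> 'b" and a b
    using admissible_extends[OF adm, of "\<lambda>\<omega>. f \<omega> = a \<and> g \<omega> = b"] admissible_extends[OF adm, of "\<lambda>\<omega>. g \<omega> = b"]
    by (simp add: cond_prob_def)
  \<comment> \<open>Positive mass puts \<open>y\<close> into \<open>\<Y>\<close>, where the
    chi-square constraint is imposed.\<close>
  have mS: "markov_chain Q (rvS \<circ> fst) (rvX \<circ> fst) snd" and mT: "markov_chain Q (rvT \<circ> fst) (rvX \<circ> fst) snd"
    and chi: "chi_square (\<lambda>s. qS $ s) (prob_at P rvS) \<le> \<epsilon>\<^sup>2"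
    using adm y admissible_support[OF adm] measure_pmf_zero_iff[of Q "{\<omega>. snd \<omega> = y}"]
    by (auto simp: admissible_def qS_def)
  have S: "qS $ s = (\<Sum>x\<in>UNIV. cprob_at P rvS s rvX x * qX $ x)" for s
    using markov_chain_sum[OF mS, of s y]
    by (simp add: qS_def qX_def cond_prob_def[of _ _ "\<lambda>\<omega>. snd \<omega> = y"] sum_divide_distrib
        conj_commute[of "snd _ = y"] flip: ext)
  have T: "qT $ t = (\<Sum>x\<in>UNIV. cprob_at P rvT t rvX x * qX $ x)" for t
    using markov_chain_sum[OF mT, of t y]
    by (simp add: qT_def qX_def cond_prob_def[of _ _ "\<lambda>\<omega>. snd \<omega> = y"] sum_divide_distrib
        conj_commute[of "snd _ = y"] flip: ext)
  have qT: "qT = cond_matrix P rvT rvX *v qX"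
    by (simp add: vec_eq_iff T cond_matrix_def matrix_vector_mult_def)
  \<comment> \<open>The channel from \<open>X\<close> to \<open>S\<close> factors through
    \<open>T\<close>, so \<open>qX\<close> can be replaced by its image \<open>qT\<close>.\<close>
  have "qS $ s = (cond_matrix P rvS rvT *v qT) $ s" for s
    unfolding S cprob_SX T matrix_vector_mult_def cond_matrix_def
    by (simp add: sum_distrib_left sum_distrib_right mult.assoc) (rule sum.swap)
  then have qS: "qS = cond_matrix P rvS rvT *v qT"
    by (simp add: vec_eq_iff)
  define l where "l = matrix_inv (diag_mat (sqrt_vec (distr_vec P rvS))) *v (qS - distr_vec P rvS)"
  have lS: "tiltS l = qS - distr_vec P rvS"
    by (simp add: tiltS_def l_def matrix_inv_vector(1)[OF invertible_diag_sqrt[OF pos_S]])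
  \<comment> \<open>The marginals satisfy the same channel equation as the conditional laws, hence
    so do the differences.\<close>
  have lT: "tiltT l = qT - distr_vec P rvT"
    by (rule tilt_unique) (simp add: lS qS matrix_vector_mult_diff_distrib flip: distr_vec_cond_matrix)
  have lX: "tiltX l = qX - distr_vec P rvX"
    by (rule tilt_unique) (simp add: lT qT matrix_vector_mult_diff_distrib flip: distr_vec_cond_matrix)
  have "(norm l)\<^sup>2 \<le> \<epsilon>\<^sup>2"
    using chi chi_square_tiltS[of l] by (simp add: lS distr_vec_def)
  then have "norm l \<le> \<epsilon>" using \<epsilon> by (simp add: power2_le_iff_abs_le)
  moreover have "orthogonal l (sqrt_vec (distr_vec P rvS))"
  proof -
    have "(\<Sum>s\<in>UNIV. qS $ s) = 1" using sum_cprob_at[OF y] by (simp add: qS_def)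
    moreover have "(\<Sum>s\<in>UNIV. prob_at P rvS s) = 1"
      using prob_eq_sum_fiber[of UNIV rvS P "\<lambda>_. True"] by simp
    ultimately show ?thesis
      using sum_tiltS[of l] by (simp add: lS orthogonal_def sum_subtractf distr_vec_def)
  qed
  ultimately show thesis
    by (rule that) (simp_all add: lT lX distr_vec_def qT_def qX_def)
qed

end

section \<open>Upper bounds on the leakage\<close>

lemma (in markov_source) mutual_info_kl:
  assumes adm: "admissible P r \<epsilon> \<Y> K Q"
  shows "mutual_info Q snd (rvT \<circ> fst) =
      (\<Sum>y\<in>\<Y>. prob_at Q snd y * kl_div (\<lambda>t. cprob_at Q (rvT \<circ> fst) t snd y) (prob_at P rvT))"
    and "mutual_info Q (rvX \<circ> fst) snd =
      (\<Sum>y\<in>\<Y>. prob_at Q snd y * kl_div (\<lambda>x. cprob_at Q (rvX \<circ> fst) x snd y) (prob_at P rvX))"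
    and "(\<Sum>y\<in>\<Y>. prob_at Q snd y) = 1"
proof -
  have T: "prob_at Q (rvT \<circ> fst) = prob_at P rvT" and X: "prob_at Q (rvX \<circ> fst) = prob_at P rvX"
    using admissible_extends[OF adm, of "\<lambda>\<omega>. rvT \<omega> = _"] admissible_extends[OF adm, of "\<lambda>\<omega>. rvX \<omega> = _"]
    by (simp_all add: fun_eq_iff)
  show "mutual_info Q snd (rvT \<circ> fst) =
      (\<Sum>y\<in>\<Y>. prob_at Q snd y * kl_div (\<lambda>t. cprob_at Q (rvT \<circ> fst) t snd y) (prob_at P rvT))"
    using mutual_info_eq_sum_kl_div(1)[OF admissible_support[OF adm], of "rvT \<circ> fst"] unfolding T .
  show "mutual_info Q (rvX \<circ> fst) snd =
      (\<Sum>y\<in>\<Y>. prob_at Q snd y * kl_div (\<lambda>x. cprob_at Q (rvX \<circ> fst) x snd y) (prob_at P rvX))"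
    using mutual_info_eq_sum_kl_div(2)[OF admissible_support[OF adm], of "rvX \<circ> fst"] unfolding X .
  show "(\<Sum>y\<in>\<Y>. prob_at Q snd y) = 1"
    using prob_eq_sum_fiber[OF admissible_support[OF adm], of "\<lambda>_. True"] by simp
qed

text \<open>Orthogonality gives the perturbations total 0, and the bounds on the tilts make them
  small relative to the marginals, so \<open>kl_div_chi_square\<close> applies with the chi-squares
  written as norms.\<close>

lemma (in markov_source) kl_div_tilt:
  assumes l: "orthogonal l (sqrt_vec (distr_vec P rvS))" and \<delta>: "C * norm l \<le> \<delta>" "\<delta> \<le> 1/2"
    and C: "\<And>l t. \<bar>tiltT l $ t\<bar> \<le> C * norm l * prob_at P rvT t"
      "\<And>l x. \<bar>tiltX l $ x\<bar> \<le> C * norm l * prob_at P rvX x"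
  shows "\<bar>kl_div (\<lambda>t. prob_at P rvT t + tiltT l $ t) (prob_at P rvT) - (norm (W_TY P *v l))\<^sup>2 / 2\<bar>
      \<le> \<delta> * (norm (W_TY P *v l))\<^sup>2"
    and "\<bar>kl_div (\<lambda>x. prob_at P rvX x + tiltX l $ x) (prob_at P rvX) - (norm (W_XY P *v l))\<^sup>2 / 2\<bar>
      \<le> \<delta> * (norm (W_XY P *v l))\<^sup>2"
proof -
  have sum: "(\<Sum>t\<in>UNIV. tiltT l $ t) = 0" "(\<Sum>x\<in>UNIV. tiltX l $ x) = 0"
    using l by (simp_all add: sum_tilt sum_tiltS orthogonal_def)
  have "\<bar>tiltT l $ t\<bar> \<le> \<delta> * prob_at P rvT t" for t
    using C(1)[of l t] mult_right_mono[OF \<delta>(1) measure_nonneg] by (rule order_trans)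
  moreover have "\<bar>tiltX l $ x\<bar> \<le> \<delta> * prob_at P rvX x" for x
    using C(2)[of l x] mult_right_mono[OF \<delta>(1) measure_nonneg] by (rule order_trans)
  ultimately show "\<bar>kl_div (\<lambda>t. prob_at P rvT t + tiltT l $ t) (prob_at P rvT) - (norm (W_TY P *v l))\<^sup>2 / 2\<bar>
      \<le> \<delta> * (norm (W_TY P *v l))\<^sup>2"
    "\<bar>kl_div (\<lambda>x. prob_at P rvX x + tiltX l $ x) (prob_at P rvX) - (norm (W_XY P *v l))\<^sup>2 / 2\<bar>
      \<le> \<delta> * (norm (W_XY P *v l))\<^sup>2"
    unfolding chi_square_tiltT[symmetric] chi_square_tiltX[symmetric]
    by (intro kl_div_chi_square pos_T pos_X \<delta>; use sum in \<open>simp add: sum.distrib\<close>)+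
qed

text \<open>Bounds the divergence for each \<open>y\<close> and averages. If \<open>r = 0\<close>,
  the divergences on the \<open>X\<close> side are nonnegative with average at most 0, so they
  vanish wherever \<open>y\<close> has mass; \<open>W_TY_eq_0\<close> carries this over to
  \<open>T\<close>.\<close>

lemma (in markov_source) mutual_info_upper:
  assumes adm: "admissible P r \<epsilon> \<Y> K Q" and \<epsilon>: "0 < \<epsilon>" "C * \<epsilon> \<le> 1/4" and "C > 0"
    and C: "\<And>l t. \<bar>tiltT l $ t\<bar> \<le> C * norm l * prob_at P rvT t"
      "\<And>l x. \<bar>tiltX l $ x\<bar> \<le> C * norm l * prob_at P rvX x"
    and M: "\<And>l. norm l \<le> 1 \<Longrightarrow> orthogonal l (sqrt_vec (distr_vec P rvS)) \<Longrightarrow> (norm (W_TY P *v l))\<^sup>2 \<le> M"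
  shows "mutual_info Q snd (rvT \<circ> fst) \<le> (1/2 + C * \<epsilon>) * (\<epsilon>\<^sup>2 * M)"
    and "r = 0 \<Longrightarrow> mutual_info Q snd (rvT \<circ> fst) = 0"
proof -
  define p where "p y = prob_at Q snd y" for y
  define D where "D y = kl_div (\<lambda>t. cprob_at Q (rvT \<circ> fst) t snd y) (prob_at P rvT)" for y
  define E where "E y = kl_div (\<lambda>x. cprob_at Q (rvX \<circ> fst) x snd y) (prob_at P rvX)" for y
  note I = mutual_info_kl[OF adm, folded p_def D_def E_def]
  have p: "p y \<ge> 0" for y by (simp add: p_def)
  \<comment> \<open>Since \<open>C * \<epsilon> \<le> 1/4\<close>, each divergence keeps at least a
    quarter of its squared norm: it is nonnegative, and \<open>E y = 0\<close> forces
    \<open>W_XY P *v l = 0\<close>.\<close>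
  have tilt: "\<exists>l. (norm (W_TY P *v l))\<^sup>2 \<le> \<epsilon>\<^sup>2 * M \<and> (W_XY P *v l = 0 \<longrightarrow> W_TY P *v l = 0) \<and>
      D y \<le> (1/2 + C * \<epsilon>) * (norm (W_TY P *v l))\<^sup>2 \<and> 0 \<le> D y \<and> (norm (W_XY P *v l))\<^sup>2 / 4 \<le> E y"
    if y: "p y > 0" for y
  proof -
    obtain l where l: "norm l \<le> \<epsilon>" "orthogonal l (sqrt_vec (distr_vec P rvS))"
      and T: "\<And>t. cprob_at Q (rvT \<circ> fst) t snd y = prob_at P rvT t + tiltT l $ t"
      and X: "\<And>x. cprob_at Q (rvX \<circ> fst) x snd y = prob_at P rvX x + tiltX l $ x"
      by (rule admissible_tilt[OF adm y[unfolded p_def] \<epsilon>(1)]) blast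
    have Cl: "C * norm l \<le> C * \<epsilon>" using l(1) \<open>C > 0\<close> by simp
    have "\<bar>D y - (norm (W_TY P *v l))\<^sup>2 / 2\<bar> \<le> C * \<epsilon> * (norm (W_TY P *v l))\<^sup>2"
      and "\<bar>E y - (norm (W_XY P *v l))\<^sup>2 / 2\<bar> \<le> C * \<epsilon> * (norm (W_XY P *v l))\<^sup>2"
      unfolding D_def E_def T X using \<epsilon>(2) by (intro kl_div_tilt[OF l(2) Cl _ C]; simp)+
    moreover have "C * \<epsilon> * (norm (W_TY P *v l))\<^sup>2 \<le> (norm (W_TY P *v l))\<^sup>2 / 4"
      "C * \<epsilon> * (norm (W_XY P *v l))\<^sup>2 \<le> (norm (W_XY P *v l))\<^sup>2 / 4"
      using mult_right_mono[OF \<epsilon>(2) zero_le_power2, of "norm (W_TY P *v l)"]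
        mult_right_mono[OF \<epsilon>(2) zero_le_power2, of "norm (W_XY P *v l)"] by simp_all
    \<comment> \<open>Rescaling by \<open>1/\<epsilon>\<close> brings \<open>l\<close> into the unit
      ball, where \<open>M\<close> is available.\<close>
    moreover have "(norm (W_TY P *v l))\<^sup>2 \<le> \<epsilon>\<^sup>2 * M"
    proof -
      have "(norm (W_TY P *v ((1/\<epsilon>) *\<^sub>R l)))\<^sup>2 \<le> M"
        using l \<epsilon>(1) by (intro M) (auto simp: orthogonal_clauses)
      then show ?thesis
        using \<epsilon>(1) by (simp add: matrix_vector_mult_scaleR power_mult_distrib power_divide field_simps)
    qed
    ultimately show ?thesis
      using W_TY_eq_0[of l] zero_le_power2[of "norm (W_TY P *v l)"]
      by (intro exI[of _ l]) (auto simp: algebra_simps)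
  qed
  have "p y * D y \<le> p y * ((1/2 + C * \<epsilon>) * (\<epsilon>\<^sup>2 * M))" for y
  proof (cases "p y = 0")
    case False
    then have "p y > 0" using p[of y] by simp
    then obtain l where "(norm (W_TY P *v l))\<^sup>2 \<le> \<epsilon>\<^sup>2 * M" "D y \<le> (1/2 + C * \<epsilon>) * (norm (W_TY P *v l))\<^sup>2"
      using tilt by blast
    moreover have "(1/2 + C * \<epsilon>) * (norm (W_TY P *v l))\<^sup>2 \<le> (1/2 + C * \<epsilon>) * (\<epsilon>\<^sup>2 * M)"
      using calculation(1) \<open>C > 0\<close> \<epsilon>(1) by (intro mult_left_mono) auto
    ultimately show ?thesis using p by (intro mult_left_mono) auto
  qed simp
  then have "(\<Sum>y\<in>\<Y>. p y * D y) \<le> (\<Sum>y\<in>\<Y>. p y * ((1/2 + C * \<epsilon>) * (\<epsilon>\<^sup>2 * M)))"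
    by (intro sum_mono)
  then show "mutual_info Q snd (rvT \<circ> fst) \<le> (1/2 + C * \<epsilon>) * (\<epsilon>\<^sup>2 * M)"
    using I(3) by (simp add: I(1) flip: sum_distrib_right)
  show "mutual_info Q snd (rvT \<circ> fst) = 0" if "r = 0"
  proof -
    have E: "p y * E y \<ge> 0" for y
    proof (cases "p y = 0")
      case False
      then have "p y > 0" using p[of y] by simp
      then obtain l where "(norm (W_XY P *v l))\<^sup>2 / 4 \<le> E y" using tilt by blast
      then have "0 \<le> E y" using zero_le_power2[of "norm (W_XY P *v l)"] by linarith
      then show ?thesis using p by simp
    qed simp
    have "(\<Sum>y\<in>\<Y>. p y * E y) \<le> 0"
      using adm that by (simp add: admissible_def flip: I(2))
    then have "(\<Sum>y\<in>\<Y>. p y * E y) = 0"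
      using sum_nonneg[of \<Y> "\<lambda>y. p y * E y"] E by fastforce
    then have E0: "p y * E y = 0" if "y \<in> \<Y>" for y
      using that E admissible_support(1)[OF adm] by (simp add: sum_nonneg_eq_0_iff)
    have "p y * D y = 0" if y: "y \<in> \<Y>" for y
    proof (cases "p y = 0")
      case False
      then have "p y > 0" using p[of y] by simp
      then obtain l where l: "W_XY P *v l = 0 \<longrightarrow> W_TY P *v l = 0"
        "D y \<le> (1/2 + C * \<epsilon>) * (norm (W_TY P *v l))\<^sup>2" "0 \<le> D y" "(norm (W_XY P *v l))\<^sup>2 / 4 \<le> E y"
        using tilt by blast
      have "E y = 0" using E0[OF y] False by simp
      with l(4) have "W_XY P *v l = 0" by simp
      with l show ?thesis by simp
    qed simp
    then show ?thesis unfolding I(1) by (rule sum.neutral[OF ballI])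
  qed
qed

section \<open>The quadratic problem\<close>

lemma pmf_with_weights:
  assumes "finite A" "\<And>a. a \<in> A \<Longrightarrow> f a \<ge> 0" "sum f A = (1 :: real)"
  obtains p where "set_pmf p \<subseteq> A" "\<And>a. a \<in> A \<Longrightarrow> pmf p a = f a"
proof -
  define g where "g a = (if a \<in> A then f a else 0)" for a
  have g: "pmf (embed_pmf g) a = g a" for a
  proof (rule pmf_embed_pmf)
    have "(\<integral>\<^sup>+a. ennreal (g a) \<partial>count_space UNIV) = (\<Sum>a\<in>A. ennreal (g a))"
      using assms(1) by (intro nn_integral_count_space'[where A = A]) (auto simp: g_def)
    also have "\<dots> = ennreal (\<Sum>a\<in>A. g a)"
      using assms(2) by (intro sum_ennreal) (auto simp: g_def)
    finally show "(\<integral>\<^sup>+a. ennreal (g a) \<partial>count_space UNIV) = 1"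
      using assms(3) by (simp add: g_def)
  qed (use assms(2) in \<open>auto simp: g_def\<close>)
  show thesis
    by (rule that[of "embed_pmf g"]) (auto simp: set_pmf_eq g g_def split: if_splits)
qed

abbreviation (input) directions :: "('s::finite \<times> 'x::finite \<times> 't::finite) pmf \<Rightarrow> (real^'s) set" where
  "directions P \<equiv> cball 0 1 \<inter> {l. orthogonal l (sqrt_vec (distr_vec P rvS))}"

lemma compact_directions: "compact (directions P)"
proof -
  have "closed {l. l \<bullet> sqrt_vec (distr_vec P rvS) = 0}"
    by (intro closed_Collect_eq continuous_intros)
  then show ?thesis
    by (auto intro!: compact_Int_closed simp: orthogonal_def)
qed

lemma P2_valuesE:
  assumes "v \<in> P2_values P r \<epsilon>"
  obtains Y :: "nat set" and p L where "v = 1/2 * \<epsilon>\<^sup>2 * (\<Sum>y\<in>Y. pmf p y * (norm (W_TY P *v L y))\<^sup>2)"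
    "finite Y" "set_pmf p \<subseteq> Y" "\<forall>y\<in>Y. L y \<in> directions P" "(\<Sum>y\<in>Y. pmf p y *\<^sub>R L y) = 0"
    "1/2 * \<epsilon>\<^sup>2 * (\<Sum>y\<in>Y. pmf p y * (norm (W_XY P *v L y))\<^sup>2) \<le> r"
proof -
  from assms obtain Y :: "nat set" and p L where *: "v = 1/2 * \<epsilon>\<^sup>2 * (\<Sum>y\<in>Y. pmf p y * (norm (W_TY P *v L y))\<^sup>2) \<and>
      finite Y \<and> set_pmf p \<subseteq> Y \<and> (\<forall>y\<in>Y. orthogonal (L y) (sqrt_vec (distr_vec P rvS))) \<and>
      (\<Sum>y\<in>Y. pmf p y *\<^sub>R L y) = 0 \<and> (\<forall>y\<in>Y. (norm (L y))\<^sup>2 \<le> 1) \<and>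
      1/2 * \<epsilon>\<^sup>2 * (\<Sum>y\<in>Y. pmf p y * (norm (W_XY P *v L y))\<^sup>2) \<le> r"
    unfolding P2_values_def by blast
  then have "L y \<in> directions P" if "y \<in> Y" for y
    using that by (simp add: abs_square_le_1)
  with * show thesis by (intro that) auto
qed

lemma P2_valuesI:
  assumes "finite (Y :: nat set)" "set_pmf p \<subseteq> Y" "\<And>y. y \<in> Y \<Longrightarrow> L y \<in> directions P" "(\<Sum>y\<in>Y. pmf p y *\<^sub>R L y) = 0"
    "1/2 * \<epsilon>\<^sup>2 * (\<Sum>y\<in>Y. pmf p y * (norm (W_XY P *v L y))\<^sup>2) \<le> r"
  shows "1/2 * \<epsilon>\<^sup>2 * (\<Sum>y\<in>Y. pmf p y * (norm (W_TY P *v L y))\<^sup>2) \<in> P2_values P r \<epsilon>"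
  unfolding P2_values_def mem_Collect_eq
  using assms by (intro exI[of _ Y] exI[of _ p] exI[of _ L]) (auto simp: abs_square_le_1)

text \<open>
  Grouping a direction with its two costs, the values of the second problem are a linear image of a
  slice of the convex hull of a compact set.
\<close>

lemma P2_values_eq:
  fixes P :: "('s::finite \<times> 'x::finite \<times> 't::finite) pmf"
  defines "F \<equiv> \<lambda>l. (l, (norm (W_TY P *v l))\<^sup>2, (norm (W_XY P *v l))\<^sup>2)"
  shows "P2_values P r \<epsilon> = (\<lambda>z. 1/2 * \<epsilon>\<^sup>2 * fst (snd z)) `
    (convex hull (F ` directions P) \<inter> {z. fst z = 0 \<and> 1/2 * \<epsilon>\<^sup>2 * snd (snd z) \<le> r})"
  (is "_ = ?f ` (?H \<inter> ?C)")
proof (intro equalityI subsetI)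
  fix v assume "v \<in> P2_values P r \<epsilon>"
  then obtain Y :: "nat set" and p L where v: "v = 1/2 * \<epsilon>\<^sup>2 * (\<Sum>y\<in>Y. pmf p y * (norm (W_TY P *v L y))\<^sup>2)"
    and Y: "finite Y" "set_pmf p \<subseteq> Y" and L: "\<forall>y\<in>Y. L y \<in> directions P"
    and sum: "(\<Sum>y\<in>Y. pmf p y *\<^sub>R L y) = 0"
    and r: "1/2 * \<epsilon>\<^sup>2 * (\<Sum>y\<in>Y. pmf p y * (norm (W_XY P *v L y))\<^sup>2) \<le> r"
    by (rule P2_valuesE) blast
  \<comment> \<open>The first coordinate of this convex combination is the mean of the directions;
    the other two are the averaged costs.\<close>
  define z where "z = (\<Sum>y\<in>Y. pmf p y *\<^sub>R F (L y))"
  have "z \<in> ?H"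
    unfolding z_def using Y L
    by (intro convex_sum) (auto simp: sum_pmf_eq_1 intro!: hull_inc)
  moreover have "z \<in> ?C" "v = ?f z"
    using sum r by (simp_all add: z_def F_def v fst_sum snd_sum)
  ultimately show "v \<in> ?f ` (?H \<inter> ?C)" by blast
next
  fix v assume "v \<in> ?f ` (?H \<inter> ?C)"
  then obtain z where z: "z \<in> ?H" "z \<in> ?C" "v = ?f z" by blast
  \<comment> \<open>A finite convex combination is itself an alphabet \<open>{1..k}\<close> with
    weights and directions.\<close>
  obtain k :: nat and u x where u: "\<And>i. i \<in> {1..k} \<Longrightarrow> 0 \<le> u i" "sum u {1..k} = 1"
    and x: "\<And>i. i \<in> {1..k} \<Longrightarrow> x i \<in> F ` directions P" and zx: "(\<Sum>i=1..k. u i *\<^sub>R x i) = z"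
    using z(1)[unfolded convex_hull_indexed, THEN CollectD] by blast
  have "\<forall>i\<in>{1..k}. \<exists>l. l \<in> directions P \<and> x i = F l"
    using x by blast
  from bchoice[OF this] obtain L where L: "\<forall>i\<in>{1..k}. L i \<in> directions P \<and> x i = F (L i)" by blast
  obtain p where p: "set_pmf p \<subseteq> {1..k}" "\<And>i. i \<in> {1..k} \<Longrightarrow> pmf p i = u i"
    by (rule pmf_with_weights[of "{1..k}" u, OF finite_atLeastAtMost u]) blast+
  have "z = (\<Sum>i=1..k. pmf p i *\<^sub>R F (L i))"
    unfolding zx[symmetric] using L p(2) by (intro sum.cong) auto
  then have zs: "fst z = (\<Sum>i=1..k. pmf p i *\<^sub>R L i)"
    "fst (snd z) = (\<Sum>i=1..k. pmf p i * (norm (W_TY P *v L i))\<^sup>2)"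
    "snd (snd z) = (\<Sum>i=1..k. pmf p i * (norm (W_XY P *v L i))\<^sup>2)"
    by (simp_all add: F_def fst_sum snd_sum)
  show "v \<in> P2_values P r \<epsilon>"
    unfolding z(3) zs(2)
  proof (rule P2_valuesI[OF finite_atLeastAtMost p(1)])
    show "(\<Sum>i=1..k. pmf p i *\<^sub>R L i) = 0" using z(2) zs(1) by simp
    show "1/2 * \<epsilon>\<^sup>2 * (\<Sum>i=1..k. pmf p i * (norm (W_XY P *v L i))\<^sup>2) \<le> r" using z(2) zs(3) by simp
  qed (use L in blast)
qed

text \<open>In finite dimension the convex hull of a compact set is compact, and so are its slice by
  closed conditions and the linear image of that slice. A nonempty compact set of reals contains its
  supremum.\<close>

lemma P2_attained:
  assumes "r \<ge> 0"
  shows "P2 P r \<epsilon> \<in> P2_values P r \<epsilon>" "v \<in> P2_values P r \<epsilon> \<Longrightarrow> v \<le> P2 P r \<epsilon>"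
proof -
  have "compact (P2_values P r \<epsilon>)"
    unfolding P2_values_eq
    by (intro compact_continuous_image compact_Int_closed compact_convex_hull compact_directions
        closed_Collect_conj closed_Collect_eq closed_Collect_le continuous_intros
        continuous_on_power continuous_on_norm matrix_vector_mult_linear_continuous_on)
  \<comment> \<open>Nonemptiness: a one-letter alphabet with the zero vector. This is feasible as
    \<open>r \<ge> 0\<close>.\<close>
  moreover have "1/2 * \<epsilon>\<^sup>2 * 0 \<in> P2_values P r \<epsilon>"
    unfolding P2_values_def mem_Collect_eq using assms
    by (intro exI[of _ "{0}"] exI[of _ "return_pmf 0"] exI[of _ "\<lambda>_. 0"]) (simp add: orthogonal_clauses)
  ultimately obtain m where m: "m \<in> P2_values P r \<epsilon>" "\<And>v. v \<in> P2_values P r \<epsilon> \<Longrightarrow> v \<le> m"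
    using compact_attains_sup[of "P2_values P r \<epsilon>"] by blast
  then have "P2 P r \<epsilon> = m"
    unfolding P2_def by (intro cSup_eq_maximum)
  then show "P2 P r \<epsilon> \<in> P2_values P r \<epsilon>" "v \<in> P2_values P r \<epsilon> \<Longrightarrow> v \<le> P2 P r \<epsilon>"
    using m by simp_all
qed

text \<open>Two letters of weight 1/2 carrying \<open>l\<close> and \<open>- l\<close> have mean 0
  and leave both squared norms unchanged. Conversely, an average of squared norms is at most their
  maximum.\<close>

lemma P2_inactive:
  fixes P :: "('s::finite \<times> 'x::finite \<times> 't::finite) pmf"
  assumes l: "l \<in> directions P" and max: "\<And>l'. l' \<in> directions P \<Longrightarrow> (norm (W_TY P *v l'))\<^sup>2 \<le> (norm (W_TY P *v l))\<^sup>2"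
    and r: "1/2 * \<epsilon>\<^sup>2 * (norm (W_XY P *v l))\<^sup>2 \<le> r"
  shows "P2 P r \<epsilon> = 1/2 * \<epsilon>\<^sup>2 * (norm (W_TY P *v l))\<^sup>2"
  unfolding P2_def
proof (rule cSup_eq_maximum)
  obtain p where p: "set_pmf p \<subseteq> {0, 1 :: nat}" "\<And>i. i \<in> {0, 1} \<Longrightarrow> pmf p i = 1/2"
    by (rule pmf_with_weights[of "{0, 1 :: nat}" "\<lambda>_. 1/2"]) auto
  define L where "L y = (if y = 0 then l else - l)" for y :: nat
  have neg: "M *v (- l) = - (M *v l)" for M :: "real^'s^'m"
    using matrix_vector_mult_diff_distrib[of M 0 l] by simp
  have L: "norm (W_TY P *v L y) = norm (W_TY P *v l)" "norm (W_XY P *v L y) = norm (W_XY P *v l)"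
    "norm (L y) = norm l" "orthogonal (L y) w \<longleftrightarrow> orthogonal l w" for y w
    by (simp_all add: L_def orthogonal_def neg)
  show "1/2 * \<epsilon>\<^sup>2 * (norm (W_TY P *v l))\<^sup>2 \<in> P2_values P r \<epsilon>"
    using P2_valuesI[OF _ p(1), of L P \<epsilon> r] p(2) l r by (simp add: L) (simp add: L_def)
next
  fix v assume "v \<in> P2_values P r \<epsilon>"
  then obtain Y :: "nat set" and p L where v: "v = 1/2 * \<epsilon>\<^sup>2 * (\<Sum>y\<in>Y. pmf p y * (norm (W_TY P *v L y))\<^sup>2)"
    and Y: "finite Y" "set_pmf p \<subseteq> Y" and L: "\<forall>y\<in>Y. L y \<in> directions P"
    by (rule P2_valuesE) blast
  have "(\<Sum>y\<in>Y. pmf p y * (norm (W_TY P *v L y))\<^sup>2) \<le> (\<Sum>y\<in>Y. pmf p y * (norm (W_TY P *v l))\<^sup>2)"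
    using max L by (intro sum_mono mult_left_mono) auto
  also have "\<dots> = (norm (W_TY P *v l))\<^sup>2"
    using Y by (simp add: sum_pmf_eq_1 flip: sum_distrib_right)
  finally show "v \<le> 1/2 * \<epsilon>\<^sup>2 * (norm (W_TY P *v l))\<^sup>2"
    unfolding v by (intro mult_left_mono) auto
qed

text \<open>The optimum is attained, so it suffices to inspect one feasible choice: at rate 0 all
  its weighted \<open>W_XY\<close> terms vanish, hence its \<open>W_TY\<close> terms do.\<close>

lemma (in markov_source) P2_rate_0:
  assumes "\<epsilon> > 0"
  shows "P2 P 0 \<epsilon> = 0"
proof -
  obtain Y :: "nat set" and p L where v: "P2 P 0 \<epsilon> = 1/2 * \<epsilon>\<^sup>2 * (\<Sum>y\<in>Y. pmf p y * (norm (W_TY P *v L y))\<^sup>2)"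
    and "finite Y" and X: "1/2 * \<epsilon>\<^sup>2 * (\<Sum>y\<in>Y. pmf p y * (norm (W_XY P *v L y))\<^sup>2) \<le> 0"
    by (rule P2_valuesE[OF P2_attained(1)[OF order_refl, of P \<epsilon>]]) blast
  have "(\<Sum>y\<in>Y. pmf p y * (norm (W_XY P *v L y))\<^sup>2) \<le> 0"
    using X assms by (simp add: mult_le_0_iff)
  then have "(\<Sum>y\<in>Y. pmf p y * (norm (W_XY P *v L y))\<^sup>2) = 0"
    by (intro antisym sum_nonneg) auto
  then have "pmf p y = 0 \<or> W_XY P *v L y = 0" if "y \<in> Y" for y
    using that \<open>finite Y\<close> by (auto simp: sum_nonneg_eq_0_iff)
  then have "pmf p y * (norm (W_TY P *v L y))\<^sup>2 = 0" if "y \<in> Y" for y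
    using that W_TY_eq_0 by fastforce
  then have "(\<Sum>y\<in>Y. pmf p y * (norm (W_TY P *v L y))\<^sup>2) = 0"
    by (rule sum.neutral[OF ballI])
  then show ?thesis unfolding v by simp
qed

section \<open>Binary extensions\<close>

text \<open>Makes \<open>Y\<close> independent of the pair \<open>(S, T)\<close> given
  \<open>X\<close>. This is stronger than the two chains through \<open>X\<close> in
  \<open>admissible\<close> and also yields the chain \<open>S - T - Y\<close>.\<close>

definition extension ::
    "('s \<times> 'x \<times> 't) pmf \<Rightarrow> ('x \<Rightarrow> nat pmf) \<Rightarrow> (('s \<times> 'x \<times> 't) \<times> nat) pmf" where
  "extension P K = bind_pmf P (\<lambda>\<omega>. map_pmf (Pair \<omega>) (K (rvX \<omega>)))"

lemma pmf_extension:
  fixes P :: "('s::finite \<times> 'x::finite \<times> 't::finite) pmf"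
  shows "pmf (extension P K) (\<omega>, y) = pmf P \<omega> * pmf (K (rvX \<omega>)) y"
proof -
  have single: "pmf (map_pmf (Pair \<omega>') (K (rvX \<omega>'))) (\<omega>, y) = (if \<omega>' = \<omega> then pmf (K (rvX \<omega>)) y else 0)" for \<omega>'
  proof (cases "\<omega>' = \<omega>")
    case True
    then show ?thesis using pmf_map_inj'[of "Pair \<omega>" "K (rvX \<omega>)" y] by (simp add: inj_on_def)
  next
    case False
    then show ?thesis by (auto simp: pmf_eq_0_set_pmf)
  qed
  show ?thesis
    unfolding extension_def pmf_bind single
    by (subst integral_measure_pmf[of UNIV]) (simp_all add: if_distrib cong: if_cong)
qed

lemma map_fst_extension: "map_pmf fst (extension P K) = P"
  by (simp add: extension_def map_bind_pmf map_pmf_comp bind_return_pmf')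

lemma prob_extension_given:
  fixes P :: "('s::finite \<times> 'x::finite \<times> 't::finite) pmf"
  shows "\<P>(z in measure_pmf (extension P K). (\<Phi> (fst z) \<and> snd z = y) \<and> rvX (fst z) = x) =
    \<P>(\<omega> in measure_pmf P. \<Phi> \<omega> \<and> rvX \<omega> = x) * pmf (K x) y"
proof -
  let ?A = "{\<omega>. \<Phi> \<omega> \<and> rvX \<omega> = x}"
  have "{z. (\<Phi> (fst z) \<and> snd z = y) \<and> rvX (fst z) = x} = (\<lambda>\<omega>. (\<omega>, y)) ` ?A"
    by force
  then have "measure (extension P K) {z. (\<Phi> (fst z) \<and> snd z = y) \<and> rvX (fst z) = x} =
      (\<Sum>\<omega>\<in>?A. pmf (extension P K) (\<omega>, y))"
    by (simp add: measure_measure_pmf_finite sum.reindex inj_on_def)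
  also have "\<dots> = (\<Sum>\<omega>\<in>?A. pmf P \<omega>) * pmf (K x) y"
    by (simp add: pmf_extension sum_distrib_right)
  also have "\<dots> = measure P ?A * pmf (K x) y"
    by (simp add: measure_measure_pmf_finite)
  finally show ?thesis by simp
qed

lemma prob_extension:
  fixes P :: "('s::finite \<times> 'x::finite \<times> 't::finite) pmf"
  shows "\<P>(z in measure_pmf (extension P K). \<Phi> (fst z) \<and> snd z = y) =
    (\<Sum>x\<in>UNIV. \<P>(\<omega> in measure_pmf P. \<Phi> \<omega> \<and> rvX \<omega> = x) * pmf (K x) y)"
  unfolding prob_extension_given[symmetric] by (rule prob_eq_sum_fiber) simp_all

lemma prob_extension_fst: "\<P>(z in measure_pmf (extension P K). \<Phi> (fst z)) = \<P>(\<omega> in measure_pmf P. \<Phi> \<omega>)"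
proof -
  have "\<P>(\<omega> in measure_pmf (map_pmf fst (extension P K)). \<Phi> \<omega>) = \<P>(z in measure_pmf (extension P K). \<Phi> (fst z))"
    by (simp add: vimage_def)
  then show ?thesis by (simp add: map_fst_extension)
qed

section \<open>Admissibility of extensions and the binary kernel\<close>

context markov_source
begin

lemma markov_chain_extension: "markov_chain (extension P K) (f \<circ> fst) (rvX \<circ> fst) snd"
  unfolding markov_chain_def
proof (intro allI impI)
  fix a b c
  have b: "prob_at (extension P K) (rvX \<circ> fst) b = prob_at P rvX b"
    using prob_extension_fst[of P K "\<lambda>\<omega>. rvX \<omega> = b"] by simp
  show "\<P>(\<omega> in measure_pmf (extension P K). (f \<circ> fst) \<omega> = a \<and> snd \<omega> = c \<bar> (rvX \<circ> fst) \<omega> = b) =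
    cprob_at (extension P K) (f \<circ> fst) a (rvX \<circ> fst) b * cprob_at (extension P K) snd c (rvX \<circ> fst) b"
    using prob_extension_given[of P K "\<lambda>\<omega>. f \<omega> = a" c b] prob_extension_given[of P K "\<lambda>_. True" c b]
      prob_extension_fst[of P K "\<lambda>\<omega>. f \<omega> = a \<and> rvX \<omega> = b"] b pos_X[of b]
    by (simp add: cond_prob_def)
qed

text \<open>After summing over \<open>x\<close>, the kernel enters only through a factor depending
  on \<open>x\<close>, so the chain \<open>S - T - X\<close> lets the conditional probability of
  \<open>S\<close> given \<open>T\<close> be pulled out. This secures
  \<open>I(Y;S|T) = 0\<close>.\<close>

lemma markov_chain_extension_STY: "markov_chain (extension P K) (rvS \<circ> fst) (rvT \<circ> fst) snd"
  unfolding markov_chain_def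
proof (intro allI impI)
  fix s t y
  have t: "prob_at (extension P K) (rvT \<circ> fst) t = prob_at P rvT t"
    using prob_extension_fst[of P K "\<lambda>\<omega>. rvT \<omega> = t"] by simp
  have "\<P>(z in measure_pmf (extension P K). (rvS (fst z) = s \<and> rvT (fst z) = t) \<and> snd z = y) =
      cprob_at P rvS s rvT t * \<P>(z in measure_pmf (extension P K). rvT (fst z) = t \<and> snd z = y)"
    using markov_chain_joint[OF markov, of s _ t]
    unfolding prob_extension[of P K "\<lambda>\<omega>. rvS \<omega> = s \<and> rvT \<omega> = t" y] prob_extension[of P K "\<lambda>\<omega>. rvT \<omega> = t" y]
    by (simp add: sum_distrib_left conj_ac mult_ac)
  then show "\<P>(\<omega> in measure_pmf (extension P K). (rvS \<circ> fst) \<omega> = s \<and> snd \<omega> = y \<bar> (rvT \<circ> fst) \<omega> = t) =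
    cprob_at (extension P K) (rvS \<circ> fst) s (rvT \<circ> fst) t * cprob_at (extension P K) snd y (rvT \<circ> fst) t"
    using prob_extension_fst[of P K "\<lambda>\<omega>. rvS \<omega> = s \<and> rvT \<omega> = t"] t pos_T[of t]
    by (simp add: cond_prob_def conj_ac)
qed

lemma tilt_scaleR: "tiltS (c *\<^sub>R l) = c *\<^sub>R tiltS l" "tiltT (c *\<^sub>R l) = c *\<^sub>R tiltT l" "tiltX (c *\<^sub>R l) = c *\<^sub>R tiltX l"
  by (simp_all add: tiltS_def tiltT_def tiltX_def matrix_vector_mult_scaleR)

text \<open>The kernel is \<open>(1 + (-1) ^ y * tiltX l $ x / prob_at P rvX x) / 2\<close>,
  nonnegative by \<open>small\<close>. As \<open>tiltX l\<close> has total 0, \<open>Y\<close> is a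
  fair bit, and Bayes' rule gives the law of \<open>X\<close> given \<open>y\<close> the tilt plus
  or minus \<open>l\<close>.\<close>

lemma binary_extension:
  assumes l: "orthogonal l (sqrt_vec (distr_vec P rvS))" "norm l \<le> \<epsilon>"
    and small: "\<And>x. \<bar>tiltX l $ x\<bar> \<le> prob_at P rvX x"
  obtains K Q where "\<And>r. mutual_info Q (rvX \<circ> fst) snd \<le> r \<Longrightarrow> admissible P r \<epsilon> {0, 1} K Q"
    "\<And>y. y \<in> {0, 1} \<Longrightarrow> prob_at Q snd y = 1/2"
    "\<And>y t. y \<in> {0, 1} \<Longrightarrow> cprob_at Q (rvT \<circ> fst) t snd y = prob_at P rvT t + tiltT ((-1) ^ y *\<^sub>R l) $ t"
    "\<And>y x. y \<in> {0, 1} \<Longrightarrow> cprob_at Q (rvX \<circ> fst) x snd y = prob_at P rvX x + tiltX ((-1) ^ y *\<^sub>R l) $ x"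
proof -
  have "\<exists>k. set_pmf k \<subseteq> {0, 1 :: nat} \<and>
      (\<forall>y\<in>{0, 1}. pmf k y = (1 + (-1) ^ y * (tiltX l $ x / prob_at P rvX x)) / 2)" for x
  proof -
    define w where "w = tiltX l $ x / prob_at P rvX x"
    define f where "f y = (1 + (-1) ^ y * w) / 2" for y :: nat
    have "\<bar>w\<bar> \<le> 1"
      using small[of x] pos_X[of x] by (simp add: w_def)
    then have nonneg: "f y \<ge> 0" if "y \<in> {0, 1}" for y
      using that by (auto simp: f_def)
    have fin: "finite {0, 1 :: nat}" and sum: "sum f {0, 1} = 1"
      by (simp_all add: f_def field_simps)
    obtain k where k: "set_pmf k \<subseteq> {0, 1}" "\<And>y. y \<in> {0, 1} \<Longrightarrow> pmf k y = f y"
      by (rule pmf_with_weights[OF fin nonneg sum]) blast+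
    show ?thesis
    proof (intro exI[of _ k] conjI ballI)
      show "pmf k y = (1 + (-1) ^ y * (tiltX l $ x / prob_at P rvX x)) / 2" if "y \<in> {0, 1}" for y
        using k(2)[OF that] by (simp only: f_def w_def)
    qed (rule k(1))
  qed
  from choice[OF allI[OF this]] obtain K where "\<forall>x. set_pmf (K x) \<subseteq> {0, 1 :: nat} \<and>
      (\<forall>y\<in>{0, 1}. pmf (K x) y = (1 + (-1) ^ y * (tiltX l $ x / prob_at P rvX x)) / 2)" ..
  then have K: "set_pmf (K x) \<subseteq> {0, 1 :: nat}"
    "y \<in> {0, 1} \<Longrightarrow> pmf (K x) y = (1 + (-1) ^ y * (tiltX l $ x / prob_at P rvX x)) / 2" for x y
    by (simp_all only:)
  define Q where "Q = extension P K"
  have sumX: "(\<Sum>x\<in>UNIV. prob_at P rvX x) = 1"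
    using prob_eq_sum_fiber[of UNIV rvX P "\<lambda>_. True"] by simp
  have joint: "\<P>(z in measure_pmf Q. f (fst z) = a \<and> snd z = y) =
      (prob_at P f a + (-1) ^ y * (\<Sum>x\<in>UNIV. cprob_at P f a rvX x * tiltX l $ x)) / 2"
    if y: "y \<in> {0, 1}" for f :: "'s \<times> 'x \<times> 't \<Rightarrow> 'b" and a y
  proof -
    have summand: "\<P>(\<omega> in measure_pmf P. f \<omega> = a \<and> rvX \<omega> = x) * pmf (K x) y =
        (\<P>(\<omega> in measure_pmf P. f \<omega> = a \<and> rvX \<omega> = x) + (-1) ^ y * (cprob_at P f a rvX x * tiltX l $ x)) / 2" for x
      using pos_X[of x] by (simp add: K(2)[OF y] cond_prob_def field_simps)
    have total: "prob_at P f a = (\<Sum>x\<in>UNIV. \<P>(\<omega> in measure_pmf P. f \<omega> = a \<and> rvX \<omega> = x))"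
      by (rule prob_eq_sum_fiber) simp_all
    show ?thesis
      unfolding Q_def prob_extension[of P K "\<lambda>\<omega>. f \<omega> = a" y] summand total
      by (simp only: sum_divide_distrib[symmetric] sum.distrib sum_distrib_left)
  qed
  have half: "prob_at Q snd y = 1/2" if y: "y \<in> {0, 1}" for y
  proof -
    have "(\<Sum>x\<in>UNIV. tiltX l $ x) = 0"
      using l(1) by (simp add: sum_tilt sum_tiltS orthogonal_def)
    moreover have "prob_at P rvX x * pmf (K x) y = (prob_at P rvX x + (-1) ^ y * tiltX l $ x) / 2" for x
      using pos_X[of x] by (simp add: K(2)[OF y] field_simps)
    ultimately have "(\<Sum>x\<in>UNIV. prob_at P rvX x * pmf (K x) y) = 1/2"
      by (simp only: sum_divide_distrib[symmetric] sum.distrib sum_distrib_left[symmetric] sumX) simp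
    then show ?thesis
      using prob_extension[of P K "\<lambda>_. True" y] by (simp add: Q_def)
  qed
  \<comment> \<open>One formula for all three variables: \<open>f\<close> decides only which channel
    is applied to \<open>tiltX l\<close>.\<close>
  have cond: "cprob_at Q (f \<circ> fst) a snd y =
      prob_at P f a + (-1) ^ y * (\<Sum>x\<in>UNIV. cprob_at P f a rvX x * tiltX l $ x)"
    if y: "y \<in> {0, 1}" for f :: "'s \<times> 'x \<times> 't \<Rightarrow> 'b" and a y
  proof -
    have "cprob_at Q (f \<circ> fst) a snd y = \<P>(z in measure_pmf Q. f (fst z) = a \<and> snd z = y) / prob_at Q snd y"
      by (simp add: cond_prob_def)
    then show ?thesis unfolding joint[OF y] half[OF y] by simp
  qed
  have T: "(\<Sum>x\<in>UNIV. cprob_at P rvT t rvX x * tiltX l $ x) = tiltT l $ t" for t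
    unfolding cond_matrix_tilt(2)[symmetric, of l] by (simp add: cond_matrix_def matrix_vector_mult_def)
  have S: "(\<Sum>x\<in>UNIV. cprob_at P rvS s rvX x * tiltX l $ x) = tiltS l $ s" for s
  proof -
    have "(\<Sum>x\<in>UNIV. cprob_at P rvS s rvX x * tiltX l $ x) = (\<Sum>t\<in>UNIV. cprob_at P rvS s rvT t * tiltT l $ t)"
      unfolding cprob_SX T[symmetric] by (simp add: sum_distrib_left sum_distrib_right mult.assoc) (rule sum.swap)
    then show ?thesis
      unfolding cond_matrix_tilt(1)[symmetric, of l] by (simp add: cond_matrix_def matrix_vector_mult_def)
  qed
  have X: "(\<Sum>x\<in>UNIV. cprob_at P rvX x' rvX x * tiltX l $ x) = tiltX l $ x'" for x'
  proof -
    \<comment> \<open>The channel from \<open>X\<close> to itself is the identity.\<close>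
    have indicator: "cprob_at P rvX x' rvX x = (if x = x' then 1 else 0)" for x
    proof (cases "x = x'")
      case False
      then have "\<P>(\<omega> in measure_pmf P. rvX \<omega> = x' \<and> rvX \<omega> = x) = 0"
        by (auto simp: measure_pmf_zero_iff)
      with False show ?thesis by (simp add: cond_prob_def)
    qed (use pos_X[of x] in \<open>simp add: cond_prob_def\<close>)
    show ?thesis unfolding indicator by (simp add: if_distrib if_distribR cong: if_cong)
  qed
  have supp: "snd ` set_pmf Q \<subseteq> {0, 1}"
    by (auto simp: Q_def extension_def dest: subsetD[OF K(1)])
  have kernel: "cprob_at Q snd y (rvX \<circ> fst) x = pmf (K x) y" for x y
    using prob_extension_given[of P K "\<lambda>_. True" y x] prob_extension_fst[of P K "\<lambda>\<omega>. rvX \<omega> = x"] pos_X[of x]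
    by (simp add: Q_def cond_prob_def)
  have chi: "chi_square (\<lambda>s. cprob_at Q (rvS \<circ> fst) s snd y) (prob_at P rvS) \<le> \<epsilon>\<^sup>2" if y: "y \<in> {0, 1}" for y
  proof -
    have "chi_square (\<lambda>s. cprob_at Q (rvS \<circ> fst) s snd y) (prob_at P rvS) = (norm ((-1) ^ y *\<^sub>R l))\<^sup>2"
      unfolding chi_square_tiltS[symmetric]
      by (simp only: cond[OF y] S tilt_scaleR vector_scaleR_component real_scaleR_def)
    also have "\<dots> \<le> \<epsilon>\<^sup>2"
      using l(2) by (simp add: power_mono power_abs)
    finally show ?thesis .
  qed
  show thesis
  proof (rule that)
    show "admissible P r \<epsilon> {0, 1} K Q" if "mutual_info Q (rvX \<circ> fst) snd \<le> r" for r
      unfolding admissible_def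
    proof (intro conjI)
      show "cond_mutual_info Q snd (rvS \<circ> fst) (rvT \<circ> fst) = 0"
        using cond_mutual_info_markov[OF markov_chain_extension_STY[of K] _ supp[unfolded Q_def]]
        by (simp add: Q_def)
    qed (use that K(1) kernel chi in \<open>simp_all add: Q_def map_fst_extension markov_chain_extension\<close>)
  qed (simp_all only: half cond T X tilt_scaleR vector_scaleR_component real_scaleR_def)
qed

text \<open>Uses the binary kernel along \<open>\<epsilon> *\<^sub>R l\<close>. Both letters have
  the same squared norms, so a single estimate bounds both divergences; hypothesis \<open>r\<close>
  leaves room for the error in the rate.\<close>

lemma mutual_info_lower:
  assumes l: "orthogonal l (sqrt_vec (distr_vec P rvS))" "norm l \<le> 1"
    and \<epsilon>: "0 < \<epsilon>" "C * \<epsilon> \<le> 1/4" and "C > 0"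
    and C: "\<And>l t. \<bar>tiltT l $ t\<bar> \<le> C * norm l * prob_at P rvT t"
      "\<And>l x. \<bar>tiltX l $ x\<bar> \<le> C * norm l * prob_at P rvX x"
    and r: "(1/2 + C * \<epsilon>) * (\<epsilon>\<^sup>2 * (norm (W_XY P *v l))\<^sup>2) \<le> r"
  obtains K Q where "admissible P r \<epsilon> {0, 1} K Q"
    "(1/2 - C * \<epsilon>) * (\<epsilon>\<^sup>2 * (norm (W_TY P *v l))\<^sup>2) \<le> mutual_info Q snd (rvT \<circ> fst)"
proof -
  define m where "m y = (-1) ^ y *\<^sub>R (\<epsilon> *\<^sub>R l)" for y :: nat
  have nm: "norm (\<epsilon> *\<^sub>R l) \<le> \<epsilon>"
    using l(2) \<epsilon>(1) by simp
  have small: "\<bar>tiltX (\<epsilon> *\<^sub>R l) $ x\<bar> \<le> prob_at P rvX x" for x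
  proof -
    have "C * norm (\<epsilon> *\<^sub>R l) \<le> C * \<epsilon>"
      using nm \<open>C > 0\<close> by (intro mult_left_mono) auto
    then have "C * norm (\<epsilon> *\<^sub>R l) * prob_at P rvX x \<le> 1 * prob_at P rvX x"
      using \<epsilon>(2) by (intro mult_right_mono) auto
    then show ?thesis using C(2)[of "\<epsilon> *\<^sub>R l" x] by simp
  qed
  have orth: "orthogonal (\<epsilon> *\<^sub>R l) (sqrt_vec (distr_vec P rvS))"
    using l(1) by (simp add: orthogonal_clauses)
  obtain K Q where adm: "\<And>r. mutual_info Q (rvX \<circ> fst) snd \<le> r \<Longrightarrow> admissible P r \<epsilon> {0, 1} K Q"
    and half: "\<And>y. y \<in> {0, 1} \<Longrightarrow> prob_at Q snd y = 1/2"
    and T: "\<And>y t. y \<in> {0, 1} \<Longrightarrow> cprob_at Q (rvT \<circ> fst) t snd y = prob_at P rvT t + tiltT (m y) $ t"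
    and X: "\<And>y x. y \<in> {0, 1} \<Longrightarrow> cprob_at Q (rvX \<circ> fst) x snd y = prob_at P rvX x + tiltX (m y) $ x"
    by (rule binary_extension[OF orth nm small, folded m_def]) blast
  define D where "D y = kl_div (\<lambda>t. prob_at P rvT t + tiltT (m y) $ t) (prob_at P rvT)" for y
  define E where "E y = kl_div (\<lambda>x. prob_at P rvX x + tiltX (m y) $ x) (prob_at P rvX)" for y
  have W: "(norm (M *v m y))\<^sup>2 = \<epsilon>\<^sup>2 * (norm (M *v l))\<^sup>2" for M :: "real^'s^'m" and y
  proof -
    have "norm (M *v m y) = \<epsilon> * norm (M *v l)"
      using \<epsilon>(1) by (simp add: m_def matrix_vector_mult_scaleR power_abs abs_mult)
    then show ?thesis by (simp add: power_mult_distrib)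
  qed
  have bounds: "\<bar>D y - (norm (W_TY P *v m y))\<^sup>2 / 2\<bar> \<le> C * \<epsilon> * (norm (W_TY P *v m y))\<^sup>2"
    "\<bar>E y - (norm (W_XY P *v m y))\<^sup>2 / 2\<bar> \<le> C * \<epsilon> * (norm (W_XY P *v m y))\<^sup>2" for y
  proof -
    have "C * norm (m y) \<le> C * \<epsilon>"
      using nm \<open>C > 0\<close> by (intro mult_left_mono) (auto simp: m_def power_abs abs_mult)
    moreover have "orthogonal (m y) (sqrt_vec (distr_vec P rvS))"
      using l(1) by (simp add: m_def orthogonal_clauses)
    ultimately show "\<bar>D y - (norm (W_TY P *v m y))\<^sup>2 / 2\<bar> \<le> C * \<epsilon> * (norm (W_TY P *v m y))\<^sup>2"
      "\<bar>E y - (norm (W_XY P *v m y))\<^sup>2 / 2\<bar> \<le> C * \<epsilon> * (norm (W_XY P *v m y))\<^sup>2"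
      unfolding D_def E_def using \<epsilon>(2) by (intro kl_div_tilt[OF _ _ _ C]; simp)+
  qed
  have I: "mutual_info Q snd (rvT \<circ> fst) = (D 0 + D 1) / 2" "mutual_info Q (rvX \<circ> fst) snd = (E 0 + E 1) / 2"
  proof -
    have "(\<Sum>y\<in>{0, 1}. prob_at Q snd y * kl_div (\<lambda>t. cprob_at Q (rvT \<circ> fst) t snd y) (prob_at P rvT)) =
        (\<Sum>y\<in>{0, 1}. 1/2 * D y)"
      "(\<Sum>y\<in>{0, 1}. prob_at Q snd y * kl_div (\<lambda>x. cprob_at Q (rvX \<circ> fst) x snd y) (prob_at P rvX)) =
        (\<Sum>y\<in>{0, 1}. 1/2 * E y)"
      by (rule sum.cong[OF refl]; simp only: half T X D_def E_def)+
    then show "mutual_info Q snd (rvT \<circ> fst) = (D 0 + D 1) / 2"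
      "mutual_info Q (rvX \<circ> fst) snd = (E 0 + E 1) / 2"
      \<comment> \<open>The rate is not yet bounded by \<open>r\<close>, so the kernel is first
        treated as admissible at its own rate.\<close>
      unfolding mutual_info_kl(1,2)[OF adm[OF order_refl]] by simp_all
  qed
  have "E y \<le> (1/2 + C * \<epsilon>) * (\<epsilon>\<^sup>2 * (norm (W_XY P *v l))\<^sup>2)" for y
    using bounds(2)[of y] by (simp add: W algebra_simps)
  then have "E y \<le> r" for y
    using r by (rule order_trans)
  from this[of 0] this[of 1] have "mutual_info Q (rvX \<circ> fst) snd \<le> r"
    unfolding I by simp
  then have "admissible P r \<epsilon> {0, 1} K Q" by (rule adm)
  moreover
  define b where "b = (1/2 - C * \<epsilon>) * (\<epsilon>\<^sup>2 * (norm (W_TY P *v l))\<^sup>2)"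
  have "b \<le> D y" for y
    using bounds(1)[of y] by (simp add: b_def W algebra_simps)
  from this[of 0] this[of 1] have "b \<le> mutual_info Q snd (rvT \<circ> fst)"
    unfolding I by simp
  ultimately show thesis unfolding b_def by (rule that)
qed

end

section \<open>Comparison of the two problems\<close>

context markov_source
begin

text \<open>A continuous function on a nonempty compact set attains its maximum. Neither \<epsilon>
  nor the rate enters, so one maximiser serves every small \<epsilon>.\<close>

lemma maximal_direction:
  obtains l where "l \<in> directions P"
    "\<And>l'. l' \<in> directions P \<Longrightarrow> (norm (W_TY P *v l'))\<^sup>2 \<le> (norm (W_TY P *v l))\<^sup>2"
proof -
  have "0 \<in> directions P"
    by (simp add: orthogonal_clauses)
  then have "directions P \<noteq> {}" by blast
  moreover have "continuous_on (directions P) (\<lambda>l. (norm (W_TY P *v l))\<^sup>2)"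
    by (intro continuous_intros continuous_on_power continuous_on_norm matrix_vector_mult_linear_continuous_on)
  ultimately have "\<exists>l\<in>directions P. \<forall>l'\<in>directions P. (norm (W_TY P *v l'))\<^sup>2 \<le> (norm (W_TY P *v l))\<^sup>2"
    using continuous_attains_sup[OF compact_directions[of P]] by blast
  then show thesis using that by auto
qed

text \<open>All admissible leakages vanish. The direction 0 supplies an admissible kernel, so the
  supremum is over \<open>{0}\<close> and not over the empty set.\<close>

lemma g_chi2_eq_0:
  assumes \<epsilon>: "0 < \<epsilon>" "C * \<epsilon> \<le> 1/4" and "C > 0"
    and C: "\<And>l t. \<bar>tiltT l $ t\<bar> \<le> C * norm l * prob_at P rvT t"
      "\<And>l x. \<bar>tiltX l $ x\<bar> \<le> C * norm l * prob_at P rvX x"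
    and M: "\<And>l. norm l \<le> 1 \<Longrightarrow> orthogonal l (sqrt_vec (distr_vec P rvS)) \<Longrightarrow> (norm (W_TY P *v l))\<^sup>2 \<le> M"
  shows "g_chi2 P 0 \<epsilon> = 0"
proof -
  have "orthogonal 0 (sqrt_vec (distr_vec P rvS))" "norm (0 :: real^'s) \<le> 1"
    "(1/2 + C * \<epsilon>) * (\<epsilon>\<^sup>2 * (norm (W_XY P *v 0))\<^sup>2) \<le> 0"
    by (simp_all add: orthogonal_clauses)
  then obtain K Q where adm: "admissible P 0 \<epsilon> {0, 1} K Q"
    by (rule mutual_info_lower[OF _ _ \<epsilon> \<open>C > 0\<close> C])
  have "mutual_info Q' snd (rvT \<circ> fst) = 0" if "admissible P 0 \<epsilon> \<Y> K' Q'" for \<Y> K' Q'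
    using mutual_info_upper(2)[OF that \<epsilon> \<open>C > 0\<close> C M] by simp
  then have "{mutual_info Q snd (rvT \<circ> fst) | \<Y> K Q. admissible P 0 \<epsilon> \<Y> K Q} = {0}"
    using adm by fastforce
  then show ?thesis by (simp add: g_chi2_def)
qed

text \<open>Maximality of \<open>l\<close> gives the upper bound for every admissible kernel, the
  binary kernel along \<open>l\<close> the lower one. The upper bound also makes the supremum well
  defined.\<close>

lemma g_chi2_bounds:
  assumes l: "l \<in> directions P"
    and max: "\<And>l'. l' \<in> directions P \<Longrightarrow> (norm (W_TY P *v l'))\<^sup>2 \<le> (norm (W_TY P *v l))\<^sup>2"
    and \<epsilon>: "0 < \<epsilon>" "C * \<epsilon> \<le> 1/4" and "C > 0"
    and C: "\<And>l t. \<bar>tiltT l $ t\<bar> \<le> C * norm l * prob_at P rvT t"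
      "\<And>l x. \<bar>tiltX l $ x\<bar> \<le> C * norm l * prob_at P rvX x"
    and r: "(1/2 + C * \<epsilon>) * (\<epsilon>\<^sup>2 * (norm (W_XY P *v l))\<^sup>2) \<le> r"
  shows "(1/2 - C * \<epsilon>) * (\<epsilon>\<^sup>2 * (norm (W_TY P *v l))\<^sup>2) \<le> g_chi2 P r \<epsilon>"
    "g_chi2 P r \<epsilon> \<le> (1/2 + C * \<epsilon>) * (\<epsilon>\<^sup>2 * (norm (W_TY P *v l))\<^sup>2)"
proof -
  let ?G = "{mutual_info Q snd (rvT \<circ> fst) | \<Y> K Q. admissible P r \<epsilon> \<Y> K Q}"
  have "orthogonal l (sqrt_vec (distr_vec P rvS))" "norm l \<le> 1"
    using l by auto
  then obtain K Q where adm: "admissible P r \<epsilon> {0, 1} K Q"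
    and lower: "(1/2 - C * \<epsilon>) * (\<epsilon>\<^sup>2 * (norm (W_TY P *v l))\<^sup>2) \<le> mutual_info Q snd (rvT \<circ> fst)"
    by (rule mutual_info_lower[OF _ _ \<epsilon> \<open>C > 0\<close> C r])
  have upper: "v \<le> (1/2 + C * \<epsilon>) * (\<epsilon>\<^sup>2 * (norm (W_TY P *v l))\<^sup>2)" if "v \<in> ?G" for v
  proof -
    have "(norm (W_TY P *v l'))\<^sup>2 \<le> (norm (W_TY P *v l))\<^sup>2"
      if "norm l' \<le> 1" "orthogonal l' (sqrt_vec (distr_vec P rvS))" for l'
      using max that by simp
    note bound = mutual_info_upper(1)[OF _ \<epsilon> \<open>C > 0\<close> C this]
    from \<open>v \<in> ?G\<close> obtain \<Y> K Q where "v = mutual_info Q snd (rvT \<circ> fst)" "admissible P r \<epsilon> \<Y> K Q"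
      by blast
    then show ?thesis using bound by simp
  qed
  have in_G: "mutual_info Q snd (rvT \<circ> fst) \<in> ?G"
    using adm by blast
  show "g_chi2 P r \<epsilon> \<le> (1/2 + C * \<epsilon>) * (\<epsilon>\<^sup>2 * (norm (W_TY P *v l))\<^sup>2)"
    unfolding g_chi2_def using in_G upper by (intro cSup_least) blast+
  have "bdd_above ?G" using upper by (rule bdd_aboveI)
  then show "(1/2 - C * \<epsilon>) * (\<epsilon>\<^sup>2 * (norm (W_TY P *v l))\<^sup>2) \<le> g_chi2 P r \<epsilon>"
    unfolding g_chi2_def using lower in_G by (intro order_trans[OF lower] cSup_upper)
qed

text \<open>For \<open>r > 0\<close> and small \<epsilon>, \<open>P2\<close> equals half of
  \<open>\<epsilon>\<^sup>2 * M\<close> and \<open>g_chi2\<close> deviates from it by at most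
  \<open>C * \<epsilon>\<close> times \<open>\<epsilon>\<^sup>2 * M\<close>, whence
  \<open>B = C * M\<close>. For \<open>r = 0\<close> both values are 0.\<close>

lemma g_chi2_approx:
  assumes "r \<ge> 0"
  obtains B where "\<forall>\<^sub>F \<epsilon> in at_right 0. \<bar>g_chi2 P r \<epsilon> - P2 P r \<epsilon>\<bar> \<le> B * \<epsilon> ^ 3"
proof -
  obtain C where "C > 0" and C: "\<And>l t. \<bar>tiltT l $ t\<bar> \<le> C * norm l * prob_at P rvT t"
    "\<And>l x. \<bar>tiltX l $ x\<bar> \<le> C * norm l * prob_at P rvX x"
    by (rule tilt_bound) blast
  obtain l where l: "l \<in> directions P"
    and max: "\<And>l'. l' \<in> directions P \<Longrightarrow> (norm (W_TY P *v l'))\<^sup>2 \<le> (norm (W_TY P *v l))\<^sup>2"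
    by (rule maximal_direction) blast
  define M where "M = (norm (W_TY P *v l))\<^sup>2"
  define N where "N = (norm (W_XY P *v l))\<^sup>2"
  have lim: "((\<lambda>\<epsilon>. C * \<epsilon>) \<longlongrightarrow> C * 0) (at_right 0)" "((\<lambda>\<epsilon>. \<epsilon>\<^sup>2 * N) \<longlongrightarrow> 0\<^sup>2 * N) (at_right 0)"
    by (intro tendsto_intros)+
  have small: "\<forall>\<^sub>F \<epsilon> in at_right 0. C * \<epsilon> < 1/4" "r > 0 \<Longrightarrow> \<forall>\<^sub>F \<epsilon> in at_right 0. \<epsilon>\<^sup>2 * N < r"
    using order_tendstoD(2)[OF lim(1), of "1/4"] order_tendstoD(2)[OF lim(2), of r] by simp_all
  have pos: "\<forall>\<^sub>F \<epsilon> :: real in at_right 0. 0 < \<epsilon>"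
    by (rule eventually_at_right_less)
  have "\<forall>\<^sub>F \<epsilon> in at_right 0. \<bar>g_chi2 P r \<epsilon> - P2 P r \<epsilon>\<bar> \<le> (C * M) * \<epsilon> ^ 3"
  proof (cases "r = 0")
    case True
    from small(1) pos show ?thesis
    proof eventually_elim
      case (elim \<epsilon>)
      have "(norm (W_TY P *v l'))\<^sup>2 \<le> M"
        if "norm l' \<le> 1" "orthogonal l' (sqrt_vec (distr_vec P rvS))" for l'
        using max that by (simp add: M_def)
      then have "g_chi2 P r \<epsilon> = 0"
        unfolding True using elim by (intro g_chi2_eq_0[OF _ _ \<open>C > 0\<close> C]) auto
      moreover have "P2 P r \<epsilon> = 0"
        unfolding True using elim by (intro P2_rate_0)
      ultimately show ?case
        using elim \<open>C > 0\<close> by (simp add: M_def)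
    qed
  next
    case False
    with assms have "r > 0" by simp
    from small(1) small(2)[OF this] pos show ?thesis
    proof eventually_elim
      case (elim \<epsilon>)
      \<comment> \<open>Both factors, \<open>1/2 + C * \<epsilon>\<close> and 1/2, are below 1, so
        \<open>\<epsilon>\<^sup>2 * N < r\<close> makes both rate constraints inactive at
        \<open>l\<close>.\<close>
      have "(1/2 + C * \<epsilon>) * (\<epsilon>\<^sup>2 * N) \<le> 1 * (\<epsilon>\<^sup>2 * N)"
        using elim by (intro mult_right_mono) (auto simp: N_def)
      then have r: "(1/2 + C * \<epsilon>) * (\<epsilon>\<^sup>2 * N) \<le> r" "1/2 * \<epsilon>\<^sup>2 * N \<le> r"
        using elim(2) \<open>r > 0\<close> by simp_all
      have "P2 P r \<epsilon> = 1/2 * \<epsilon>\<^sup>2 * M"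
        unfolding M_def using l max r(2) by (intro P2_inactive) (auto simp: N_def)
      moreover have "(1/2 - C * \<epsilon>) * (\<epsilon>\<^sup>2 * M) \<le> g_chi2 P r \<epsilon>" "g_chi2 P r \<epsilon> \<le> (1/2 + C * \<epsilon>) * (\<epsilon>\<^sup>2 * M)"
        unfolding M_def using elim r(1) less_imp_le[OF elim(1)]
        by (intro g_chi2_bounds[OF l max elim(3) _ \<open>C > 0\<close> C]; simp add: N_def)+
      ultimately show ?case
        by (simp add: abs_le_iff algebra_simps power2_eq_square power3_eq_cube)
    qed
  qed
  then show thesis by (rule that)
qed

end

theorem theorem1:
  fixes P :: "('s::finite \<times> 'x::finite \<times> 't::finite) pmf" and r :: real
  assumes "\<And>s. prob_at P rvS s > 0"
    and "\<And>x. prob_at P rvX x > 0"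
    and "\<And>t. prob_at P rvT t > 0"
    and "markov_chain P rvS rvT rvX"
    and "invertible (cond_matrix P rvT rvX)"
    and "invertible (cond_matrix P rvS rvT)"
    and "r \<ge> 0"
  shows "(\<forall>\<epsilon>. 0 < \<epsilon> \<and> \<epsilon> < min (c1 P) (c2 P) \<longrightarrow>
            P2 P r \<epsilon> \<in> P2_values P r \<epsilon> \<and> (\<forall>v \<in> P2_values P r \<epsilon>. v \<le> P2 P r \<epsilon>)) \<and>
         (\<exists>f :: real \<Rightarrow> real.
            (\<forall>\<epsilon>. 0 < \<epsilon> \<and> \<epsilon> < min (c1 P) (c2 P) \<longrightarrow>
               g_chi2 P r \<epsilon> = P2 P r \<epsilon> + f \<epsilon>) \<and>
            ((\<lambda>\<epsilon>. f \<epsilon> / \<epsilon>\<^sup>2) \<longlongrightarrow> 0) (at_right 0))"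
proof (intro conjI allI impI)
  fix \<epsilon>
  show "P2 P r \<epsilon> \<in> P2_values P r \<epsilon>" "\<forall>v \<in> P2_values P r \<epsilon>. v \<le> P2 P r \<epsilon>"
    using P2_attained[OF assms(7)] by blast+
next
  interpret markov_source P
    using assms(1-6) by unfold_locales
  obtain B where B: "\<forall>\<^sub>F \<epsilon> in at_right 0. \<bar>g_chi2 P r \<epsilon> - P2 P r \<epsilon>\<bar> \<le> B * \<epsilon> ^ 3"
    by (rule g_chi2_approx[OF assms(7)])
  have "((\<lambda>\<epsilon>. (g_chi2 P r \<epsilon> - P2 P r \<epsilon>) / \<epsilon>\<^sup>2) \<longlongrightarrow> 0) (at_right 0)"
  proof (rule Lim_null_comparison)
    show "\<forall>\<^sub>F \<epsilon> in at_right 0. norm ((g_chi2 P r \<epsilon> - P2 P r \<epsilon>) / \<epsilon>\<^sup>2) \<le> B * \<epsilon>"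
      using B eventually_at_right_less[of 0]
    proof eventually_elim
      case (elim \<epsilon>)
      then show ?case by (simp add: field_simps power2_eq_square power3_eq_cube)
    qed
    have "((\<lambda>\<epsilon>. B * \<epsilon>) \<longlongrightarrow> B * 0) (at_right 0)"
      by (intro tendsto_intros)
    then show "((\<lambda>\<epsilon>. B * \<epsilon>) \<longlongrightarrow> 0) (at_right 0)" by simp
  qed
  then show "\<exists>f. (\<forall>\<epsilon>. 0 < \<epsilon> \<and> \<epsilon> < min (c1 P) (c2 P) \<longrightarrow> g_chi2 P r \<epsilon> = P2 P r \<epsilon> + f \<epsilon>) \<and>
      ((\<lambda>\<epsilon>. f \<epsilon> / \<epsilon>\<^sup>2) \<longlongrightarrow> 0) (at_right 0)"
    \<comment> \<open>With the difference as \<open>f\<close> the identity is immediate, and the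
      limit above is the whole content.\<close>
    by (intro exI[of _ "\<lambda>\<epsilon>. g_chi2 P r \<epsilon> - P2 P r \<epsilon>"]) simp
qed

end
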